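(* Let $p_{m,n}$ be the number of staircase polygons on the square lattice of half-perimeter $m$ and area $n$, let $\widetilde X_m$ ($m\ge2$) be the random variable with $\mathbb P(\widetilde X_m=n)=p_{m,n}/\sum_n p_{m,n}$, and put $X_m=\widetilde X_m/m^{3/2}$. Then $$\frac{X_m}{\sqrt{\pi}/4}\ \stackrel{d}{\longrightarrow}\ \frac{Y}{\sqrt{\pi}}\qquad (m\to\infty)$$ (convergence in distribution), where $Y$ is Airy distributed. Moreover, all moments of $\frac{X_m}{\sqrt\pi/4}$ converge to the corresponding moments of $Y/\sqrt\pi$.
   Context: A staircase polygon is a square lattice polygon whose boundary consists of two lattice paths using only unit north and east steps, having common start point and common end point and no other point in common; polygons are counted up to translation. Half-perimeter is half the number of boundary edges, area is the number of enclosed unit squares. The generating function $P(x,q)=\sum_{m,n}p_{m,n}x^mq^n$ is the unique power series with $P(0,q)=0$ satisfying $P(x,q)=\dfrac{x^2q}{1-2xq-P(qx,q)}$. Airy distribution: a random variable $Y$ is Airy distributed if for all $k\in\mathbb N_0$ $$\frac{\mathbb E[Y^k]}{k!}=\frac{\Gamma(\gamma_0)}{\Gamma(\gamma_k)}\frac{\phi_k}{\phi_0},\qquad \gamma_k=\frac{3k}{2}-\frac12,$$ where $\phi_0=-1$ and, for $k\ge1$, $\gamma_{k-1}\phi_{k-1}+\frac12\sum_{l=0}^k\phi_l\phi_{k-l}=0$. These moments satisfy the Carleman condition, so they determine the distribution uniquely; $\mathbb E[Y]=\sqrt\pi$. *)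

theory Defs
  imports "HOL-Probability.Probability"
begin

datatype step = North | East

text \<open>A lattice path with unit north and east steps, starting at the origin, is given by its
  list of steps.\<close>

definition endpoint :: "step list \<Rightarrow> nat \<times> nat" where
  "endpoint w = (count_list w East, count_list w North)"

definition vertices :: "step list \<Rightarrow> (nat \<times> nat) set" where
  "vertices w = {endpoint (take k w) | k. k \<le> length w}"

text \<open>The left ends of the horizontal unit edges traversed by the path.\<close>

definition east_edges :: "step list \<Rightarrow> (nat \<times> nat) set" where
  "east_edges w = {endpoint (take k w) | k. k < length w \<and> w ! k = East}"

text \<open>A staircase polygon is represented by the pair \<open>(u, l)\<close> of its upper and lower boundary path.
  Taking the origin as the common starting point selects exactly one polygon from each translation
  class, and listing first the path that begins with a north step selects one of the two orders of
  the pair. The condition on the first steps also rules out two copies of a single edge, which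
  do not bound a polygon; otherwise, paths that share no vertex besides the two endpoints share no
  point of their edges either.\<close>

definition staircase_polygon :: "step list \<times> step list \<Rightarrow> bool" where
  "staircase_polygon = (\<lambda>(u, l).
     u \<noteq> [] \<and> hd u = North \<and> l \<noteq> [] \<and> hd l = East \<and>
     endpoint u = endpoint l \<and>
     vertices u \<inter> vertices l = {(0, 0), endpoint u})"

definition half_perimeter :: "step list \<times> step list \<Rightarrow> nat" where
  "half_perimeter = (\<lambda>(u, l). (length u + length l) div 2)"

text \<open>A unit square is named by its lower left corner \<open>(i, j)\<close>; it is enclosed if it lies above the
  horizontal edge of the lower path and below that of the upper path in column \<open>i\<close>.\<close>

definition enclosed_squares :: "step list \<times> step list \<Rightarrow> (nat \<times> nat) set" where
  "enclosed_squares = (\<lambda>(u, l).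
     {(i, j). \<exists>a b. (i, a) \<in> east_edges l \<and> (i, b) \<in> east_edges u \<and> a \<le> j \<and> j + 1 \<le> b})"

definition area :: "step list \<times> step list \<Rightarrow> nat" where
  "area p = card (enclosed_squares p)"

definition num_polygons :: "nat \<Rightarrow> nat \<Rightarrow> nat" where
  "num_polygons m n = card {p. staircase_polygon p \<and> half_perimeter p = m \<and> area p = n}"

definition airy_gamma :: "nat \<Rightarrow> real" where
  "airy_gamma k = 3 * real k / 2 - 1 / 2"

text \<open>The quadratic recurrence for \<open>\<phi>\<close>, solved for its top coefficient; see \<open>airy_phi_unique\<close>
  for the original form.\<close>

fun airy_phi :: "nat \<Rightarrow> real" where
  "airy_phi 0 = -1"
| "airy_phi (Suc k) = airy_gamma k * airy_phi k
     + 1 / 2 * (\<Sum>l = 1..k. airy_phi l * airy_phi (Suc k - l))"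

lemma airy_recurrence_solve:
  fixes f :: "nat \<Rightarrow> real"
  assumes "f 0 = -1"
  shows "g * f k + 1 / 2 * (\<Sum>l = 0..Suc k. f l * f (Suc k - l)) = 0
    \<longleftrightarrow> f (Suc k) = g * f k + 1 / 2 * (\<Sum>l = 1..k. f l * f (Suc k - l))"
proof -
  have "(\<Sum>l = 0..Suc k. f l * f (Suc k - l))
      = f 0 * f (Suc k) + (\<Sum>l = 1..k. f l * f (Suc k - l)) + f (Suc k) * f 0"
    by (simp add: sum.atLeast_Suc_atMost)
  then show ?thesis using assms by (simp only:) (auto simp: algebra_simps)
qed

lemma airy_phi_unique:
  fixes f :: "nat \<Rightarrow> real"
  shows "f 0 = -1 \<and>
      (\<forall>k\<ge>1. airy_gamma (k - 1) * f (k - 1) + 1 / 2 * (\<Sum>l = 0..k. f l * f (k - l)) = 0)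
    \<longleftrightarrow> f = airy_phi"
    (is "f 0 = -1 \<and> ?rec f \<longleftrightarrow> _")
proof -
  have rec: "?rec h \<longleftrightarrow> (\<forall>k. h (Suc k) = airy_gamma k * h k
      + 1 / 2 * (\<Sum>l = 1..k. h l * h (Suc k - l)))" if "h 0 = -1" for h :: "nat \<Rightarrow> real"
  proof -
    have "?rec h \<longleftrightarrow>
        (\<forall>k. airy_gamma k * h k + 1 / 2 * (\<Sum>l = 0..Suc k. h l * h (Suc k - l)) = 0)"
    proof (intro iffI allI impI)
      fix k assume "?rec h"
      from this[rule_format, of "Suc k"]
      show "airy_gamma k * h k + 1 / 2 * (\<Sum>l = 0..Suc k. h l * h (Suc k - l)) = 0"
        by (simp only: diff_Suc_1 diff_Suc_Suc diff_zero One_nat_def Suc_le_mono le0 True_implies_equals)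
    next
      fix k :: nat
      assume h: "\<forall>k. airy_gamma k * h k + 1 / 2 * (\<Sum>l = 0..Suc k. h l * h (Suc k - l)) = 0"
        and "1 \<le> k"
      then obtain j where k: "k = Suc j" by (metis One_nat_def Suc_le_D)
      show "airy_gamma (k - 1) * h (k - 1) + 1 / 2 * (\<Sum>l = 0..k. h l * h (k - l)) = 0"
        unfolding k diff_Suc_1 using h by blast
    qed
    then show ?thesis by (simp only: airy_recurrence_solve[where f = h, OF that])
  qed
  show ?thesis
  proof
    assume f: "f 0 = -1 \<and> ?rec f"
    then have f0: "f 0 = -1" by blast
    have fS: "f (Suc k) = airy_gamma k * f k
        + 1 / 2 * (\<Sum>l = 1..k. f l * f (Suc k - l))" for k
      using f rec[of f, OF f0] by blast
    have "f n = airy_phi n" for n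
    proof (induction n rule: less_induct)
      case (less n)
      show ?case
      proof (cases n)
        case 0
        then show ?thesis using f0 by simp
      next
        case (Suc k)
        have "(\<Sum>l = 1..k. f l * f (Suc k - l))
            = (\<Sum>l = 1..k. airy_phi l * airy_phi (Suc k - l))"
          by (rule sum.cong) (auto simp: less Suc)
        then show ?thesis using fS[of k] less[of k] Suc by simp
      qed
    qed
    then show "f = airy_phi" by blast
  next
    assume "f = airy_phi"
    then show "f 0 = -1 \<and> ?rec f" using rec[of airy_phi] by simp
  qed
qed

definition airy_distributed :: "'a measure \<Rightarrow> ('a \<Rightarrow> real) \<Rightarrow> bool" where
  "airy_distributed M Y \<longleftrightarrow>
     prob_space M \<and> Y \<in> borel_measurable M \<and>
     (\<forall>k. integrable M (\<lambda>\<omega>. Y \<omega> ^ k) \<and>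
        (\<integral>\<omega>. Y \<omega> ^ k \<partial>M) / fact k
          = Gamma (airy_gamma 0) / Gamma (airy_gamma k) * (airy_phi k / airy_phi 0))"

end

theory Submission
  imports Defs "HOL-Computational_Algebra.Formal_Power_Series"
begin

text \<open>The distance between the two boundary paths of a staircase polygon performs a two-coloured
  Motzkin excursion whose heights add up to the area, which yields the functional equation for
  \<open>P(x, q)\<close>. Put \<open>q = exp s\<close> and expand in powers of \<open>s\<close>: the coefficient of \<open>s^k\<close> is the generating
  function of the \<open>k\<close>-th area moments divided by \<open>k!\<close>, and the functional equation determines it
  recursively as a Laurent polynomial in \<open>y = sqrt (1 - 4x)\<close>. Its most singular term is
  \<open>f k * y^(1 - 3k)\<close>, where comparing leading coefficients gives the recurrence of the numbers
  \<open>airy_phi k / (2 * 4^k)\<close> for \<open>f k\<close>. The coefficient asymptotics of the powers of \<open>y\<close> give the convergence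
  of all moments, and since the moments of the Airy distribution grow slowly enough for its
  characteristic function to be entire, convergence in distribution follows by Levy's
  continuity theorem.\<close>

unbundle no vec_syntax and fps_syntax

section \<open>Power series with a square root singularity\<close>

text \<open>\<open>sqrt_pow j\<close> is the power series of \<open>(1 - 4x)\<close> raised to the power \<open>- j / 2\<close>.\<close>

definition sqrt_pow :: "int \<Rightarrow> real fps" where
  "sqrt_pow j = Abs_fps (\<lambda>n. 4 ^ n * pochhammer (of_int j / 2) n / fact n)"

lemma sqrt_pow_0: "sqrt_pow 0 = 1"
  by (rule fps_ext) (auto simp: sqrt_pow_def pochhammer_0_left)

text \<open>This is the Vandermonde convolution of Pochhammer symbols.\<close>

lemma sqrt_pow_mult: "sqrt_pow i * sqrt_pow j = sqrt_pow (i + j)"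
proof (rule fps_ext)
  fix n
  have "(sqrt_pow i * sqrt_pow j) $ n =
      (\<Sum>k\<le>n. 4 ^ n / fact n * (of_nat (n choose k) * pochhammer (of_int i / 2) k
        * pochhammer (of_int j / 2) (n - k)))"
    unfolding fps_mult_nth atLeast0AtMost sqrt_pow_def
    by (rule sum.cong) (auto simp: binomial_fact field_simps simp flip: power_add)
  also have "\<dots> = sqrt_pow (i + j) $ n"
    by (simp add: sqrt_pow_def pochhammer_binomial_sum add_divide_distrib sum_distrib_left
        sum_divide_distrib)
  finally show "(sqrt_pow i * sqrt_pow j) $ n = sqrt_pow (i + j) $ n" .
qed

text \<open>\<open>pochhammer (-1) n\<close> vanishes from \<open>n = 2\<close> on. With
  \<open>sqrt_pow_mult\<close> this makes \<open>sqrt_pow (-1)\<close> a square root of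
  \<open>1 - 4x\<close>, called \<open>y\<close> below.\<close>

lemma sqrt_pow_minus_2: "sqrt_pow (-2) = 1 - 4 * fps_X"
proof (rule fps_ext)
  fix n :: nat
  have "n = 0 \<or> n = 1 \<or> (\<exists>m. n = Suc (Suc m))"
    by presburger
  then show "sqrt_pow (-2) $ n = (1 - 4 * fps_X) $ n"
    by (auto simp: sqrt_pow_def pochhammer_rec numeral_fps_const)
qed

section \<open>The Euler operator \<open>x d/dx\<close>\<close>

definition theta :: "real fps \<Rightarrow> real fps" where
  "theta F = fps_X * fps_deriv F"

lemma theta_nth: "theta F $ n = of_nat n * F $ n"
  by (cases n) (auto simp: theta_def)

lemma theta_funpow_nth: "(theta ^^ i) F $ n = of_nat n ^ i * F $ n"
  by (induction i) (auto simp: theta_nth)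

lemma theta_add: "theta (F + G) = theta F + theta G"
  by (rule fps_ext) (simp add: theta_nth algebra_simps)

lemma theta_diff: "theta (F - G) = theta F - theta G"
  by (rule fps_ext) (simp add: theta_nth algebra_simps)

lemma theta_0: "theta 0 = 0"
  by (simp add: theta_def)

lemma theta_scale: "theta (fps_const c * F) = fps_const c * theta F"
  by (rule fps_ext) (simp add: theta_nth)

text \<open>Differentiating \<open>y^(-j)\<close> and multiplying by \<open>x\<close> gives
  \<open>2 j x y^(-j-2)\<close>, and \<open>4x = 1 - y^2\<close>. One application of
  \<open>theta\<close> thus raises the order of the singularity by 2.\<close>

lemma theta_sqrt_pow:
  "theta (sqrt_pow j) = fps_const (of_int j / 2) * (sqrt_pow (j + 2) - sqrt_pow j)"
proof (rule fps_ext)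
  fix n
  define a :: real where "a = of_int j / 2"
  have "a * pochhammer (a + 1) n = pochhammer a n * (a + of_nat n)"
    using pochhammer_rec[of a n] pochhammer_rec'[of a n] by (simp add: mult.commute)
  then have "of_nat n * pochhammer a n = a * (pochhammer (a + 1) n - pochhammer a n)"
    by (simp add: algebra_simps)
  moreover have "theta (sqrt_pow j) $ n = 4 ^ n * (of_nat n * pochhammer a n) / fact n"
    by (simp add: theta_nth sqrt_pow_def a_def)
  moreover have "(fps_const (of_int j / 2) * (sqrt_pow (j + 2) - sqrt_pow j)) $ n
      = 4 ^ n * (a * (pochhammer (a + 1) n - pochhammer a n)) / fact n"
    by (simp add: sqrt_pow_def a_def add_divide_distrib diff_divide_distrib right_diff_distrib mult_ac)
  ultimately show "theta (sqrt_pow j) $ n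
      = (fps_const (of_int j / 2) * (sqrt_pow (j + 2) - sqrt_pow j)) $ n"
    by simp
qed

text \<open>The Laurent polynomials in \<open>y\<close> without exponents below \<open>-j\<close>,
  built one term at a time so that closure properties follow by induction.\<close>

inductive_set sing_le :: "int \<Rightarrow> real fps set" for j where
  zero: "0 \<in> sing_le j"
| step: "F \<in> sing_le j \<Longrightarrow> i \<le> j \<Longrightarrow> F + fps_const c * sqrt_pow i \<in> sing_le j"

lemma sing_le_sqrt_pow: "i \<le> j \<Longrightarrow> fps_const c * sqrt_pow i \<in> sing_le j"
  using sing_le.step[OF sing_le.zero, of i j c] by simp

lemma sing_le_mono: "F \<in> sing_le i \<Longrightarrow> i \<le> j \<Longrightarrow> F \<in> sing_le j"
  by (induction rule: sing_le.induct) (auto intro: sing_le.intros)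

lemma sing_le_add: "F \<in> sing_le j \<Longrightarrow> G \<in> sing_le j \<Longrightarrow> F + G \<in> sing_le j"
proof (induction F rule: sing_le.induct)
  case (step F i c)
  then have "F + G + fps_const c * sqrt_pow i \<in> sing_le j"
    by (intro sing_le.step) auto
  then show ?case by (simp add: algebra_simps)
qed simp

lemma sing_le_scale: "F \<in> sing_le j \<Longrightarrow> fps_const c * F \<in> sing_le j"
proof (induction F rule: sing_le.induct)
  case (step F i d)
  then have "fps_const c * F + fps_const (c * d) * sqrt_pow i \<in> sing_le j"
    by (intro sing_le.step) auto
  then show ?case by (simp add: algebra_simps flip: fps_const_mult)
qed (simp add: sing_le.zero)

lemma sing_le_sum: "(\<And>x. x \<in> S \<Longrightarrow> f x \<in> sing_le j) \<Longrightarrow> (\<Sum>x\<in>S. f x) \<in> sing_le j"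
  by (induction S rule: infinite_finite_induct) (auto intro: sing_le.zero sing_le_add)

lemma sing_le_diff: "F \<in> sing_le j \<Longrightarrow> G \<in> sing_le j \<Longrightarrow> F - G \<in> sing_le j"
  using sing_le_add[of F j "fps_const (-1) * G"] sing_le_scale[of G j "-1"]
  by (simp flip: fps_const_neg)

lemma sing_le_mult_sqrt_pow: "F \<in> sing_le j \<Longrightarrow> F * sqrt_pow i \<in> sing_le (j + i)"
proof (induction F rule: sing_le.induct)
  case (step F k c)
  then have "F * sqrt_pow i + fps_const c * sqrt_pow (k + i) \<in> sing_le (j + i)"
    by (intro sing_le.step) auto
  then show ?case by (simp add: algebra_simps flip: sqrt_pow_mult)
qed (simp add: sing_le.zero)

lemma sing_le_mult:
  assumes "F \<in> sing_le i" "G \<in> sing_le j"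
  shows "F * G \<in> sing_le (i + j)"
  using assms(2)
proof (induction G rule: sing_le.induct)
  case (step G k c)
  have "F * sqrt_pow k \<in> sing_le (i + j)"
    using sing_le_mono[OF sing_le_mult_sqrt_pow[OF assms(1), of k]] step by simp
  then have "F * G + fps_const c * (F * sqrt_pow k) \<in> sing_le (i + j)"
    using step by (intro sing_le_add sing_le_scale)
  then show ?case by (simp add: algebra_simps)
qed (simp add: sing_le.zero)

lemma sing_le_theta: "F \<in> sing_le j \<Longrightarrow> theta F \<in> sing_le (j + 2)"
proof (induction F rule: sing_le.induct)
  case (step F i c)
  have "theta (sqrt_pow i) \<in> sing_le (j + 2)"
    unfolding theta_sqrt_pow right_diff_distrib using step
    by (intro sing_le_diff sing_le_sqrt_pow) auto
  then show ?case using step by (auto simp: theta_add theta_scale intro: sing_le_add sing_le_scale)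
qed (simp add: sing_le.zero theta_0)

lemma sing_le_theta_funpow: "F \<in> sing_le j \<Longrightarrow> (theta ^^ i) F \<in> sing_le (j + 2 * int i)"
proof (induction i)
  case (Suc i)
  from sing_le_theta[OF Suc.IH[OF Suc.prems]] show ?case by (simp add: algebra_simps)
qed simp

lemma sing_le_const: "0 \<le> j \<Longrightarrow> fps_const c \<in> sing_le j"
  using sing_le_sqrt_pow[of 0 j c] by (simp add: sqrt_pow_0)

lemma sing_le_X: "0 \<le> j \<Longrightarrow> fps_X \<in> sing_le j"
proof -
  assume "0 \<le> j"
  have "fps_X = fps_const (1/4) - fps_const (1/4) * sqrt_pow (-2)"
    unfolding sqrt_pow_minus_2 by (rule fps_ext) (simp add: numeral_fps_const)
  also have "\<dots> \<in> sing_le j"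
    using \<open>0 \<le> j\<close> by (intro sing_le_diff sing_le_const sing_le_sqrt_pow) auto
  finally show ?thesis .
qed

text \<open>The coefficient \<open>c\<close> may be \<open>0\<close>, so that \<open>lead F j\<close> also applies to series of lower order.\<close>

definition lead :: "real fps \<Rightarrow> int \<Rightarrow> real \<Rightarrow> bool" where
  "lead F j c \<longleftrightarrow> F - fps_const c * sqrt_pow j \<in> sing_le (j - 1)"

lemma lead_sing_le: "lead F j c \<Longrightarrow> F \<in> sing_le j"
  unfolding lead_def
  using sing_le.step[OF sing_le_mono, of "F - fps_const c * sqrt_pow j" "j - 1" j j c] by simp

lemma lead_small: "F \<in> sing_le i \<Longrightarrow> i < j \<Longrightarrow> lead F j 0"
  by (auto simp: lead_def intro: sing_le_mono)

lemma lead_add: "lead F j c \<Longrightarrow> lead G j d \<Longrightarrow> lead (F + G) j (c + d)"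
  using sing_le_add[of "F - fps_const c * sqrt_pow j" "j - 1" "G - fps_const d * sqrt_pow j"]
  by (simp add: lead_def algebra_simps flip: fps_const_add)

lemma lead_0: "lead 0 j 0"
  by (simp add: lead_def sing_le.zero)

lemma lead_sum: "(\<And>x. x \<in> S \<Longrightarrow> lead (f x) j (c x)) \<Longrightarrow> lead (\<Sum>x\<in>S. f x) j (\<Sum>x\<in>S. c x)"
  by (induction S rule: infinite_finite_induct)
    (auto intro: lead_add simp: lead_0)

text \<open>The error splits as \<open>(F - c y^(-i)) G + c y^(-i) (G - d y^(-j))\<close>, and each
  part loses one order.\<close>

lemma lead_mult:
  assumes "lead F i c" "lead G j d"
  shows "lead (F * G) (i + j) (c * d)"
proof -
  let ?F = "F - fps_const c * sqrt_pow i" and ?G = "G - fps_const d * sqrt_pow j"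
  have "?F * G \<in> sing_le (i + j - 1)"
    using sing_le_mult[of ?F "i - 1" G j] assms lead_sing_le[OF assms(2)]
    by (simp add: lead_def algebra_simps)
  moreover have "fps_const c * (?G * sqrt_pow i) \<in> sing_le (i + j - 1)"
    using sing_le_scale[OF sing_le_mult_sqrt_pow, of ?G "j - 1" c i] assms
    by (simp add: lead_def algebra_simps)
  ultimately have "?F * G + fps_const c * (?G * sqrt_pow i) \<in> sing_le (i + j - 1)"
    by (rule sing_le_add)
  also have "?F * G + fps_const c * (?G * sqrt_pow i) = F * G - fps_const (c * d) * sqrt_pow (i + j)"
    by (simp add: algebra_simps flip: sqrt_pow_mult fps_const_mult)
  finally show ?thesis by (simp add: lead_def)
qed

lemma lead_sqrt_pow: "lead (sqrt_pow j) j 1"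
  by (simp add: lead_def sing_le.zero)

text \<open>Of the two terms in \<open>theta_sqrt_pow\<close> only the first reaches order
  \<open>j + 2\<close>; the second and the image of the remainder have order at most
  \<open>j + 1\<close>.\<close>

lemma lead_theta:
  assumes "lead F j c"
  shows "lead (theta F) (j + 2) (of_int j / 2 * c)"
proof -
  have "theta (F - fps_const c * sqrt_pow j) \<in> sing_le (j + 1)"
    using sing_le_theta[of _ "j - 1"] assms unfolding lead_def by (simp add: algebra_simps)
  moreover have "fps_const (c * of_int j / 2) * sqrt_pow j \<in> sing_le (j + 1)"
    by (rule sing_le_sqrt_pow) simp
  ultimately have "theta (F - fps_const c * sqrt_pow j) - fps_const (c * of_int j / 2) * sqrt_pow j
      \<in> sing_le (j + 1)"
    by (rule sing_le_diff)
  also have "theta (F - fps_const c * sqrt_pow j) - fps_const (c * of_int j / 2) * sqrt_pow j =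
     theta F - fps_const (of_int j / 2 * c) * sqrt_pow (j + 2)"
    unfolding theta_diff theta_scale theta_sqrt_pow by (rule fps_ext) (simp add: algebra_simps)
  finally show ?thesis
    by (simp add: lead_def algebra_simps)
qed

section \<open>Asymptotics of coefficients\<close>

text \<open>With \<open>a = j / 2\<close>, the quotient is \<open>n / (a + n)\<close> times Gauss'
  product for \<open>1 / Gamma a\<close>. Using \<open>rGamma\<close> includes the polynomials of
  even \<open>j <= 0\<close>, where the limit is 0.\<close>

lemma sqrt_pow_asymp:
  "(\<lambda>n. sqrt_pow j $ n / (4 ^ n * real n powr (of_int j / 2 - 1)))
    \<longlonglongrightarrow> rGamma (of_int j / 2)"
proof -
  define a :: real where "a = of_int j / 2"
  have "(\<lambda>n. 1 / (a * inverse (real n) + 1)) \<longlonglongrightarrow> 1 / (a * 0 + 1)"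
    by (intro tendsto_intros lim_inverse_n) simp
  from tendsto_mult[OF rGamma_series_LIMSEQ[of a] this]
  have "(\<lambda>n. rGamma_series a n * (1 / (a * inverse (real n) + 1))) \<longlonglongrightarrow> rGamma a" by simp
  moreover have "eventually (\<lambda>n. rGamma_series a n * (1 / (a * inverse (real n) + 1))
      = sqrt_pow j $ n / (4 ^ n * real n powr (a - 1))) sequentially"
    \<comment> \<open>Beyond the absolute value of \<open>a\<close> the denominator
      \<open>a + n\<close> cannot vanish.\<close>
    using eventually_gt_at_top[of 0] eventually_gt_at_top[of "nat \<lceil>\<bar>a\<bar>\<rceil>"]
  proof eventually_elim
    case (elim n)
    then have "a + real n \<noteq> 0" by linarith
    moreover from this elim have "(a + real n) / (a * inverse (real n) + 1) = real n"
      by (simp add: field_simps)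
    moreover have "real n powr (a - 1) = exp (a * ln (real n)) / real n"
      using elim by (simp add: powr_def algebra_simps exp_diff)
    moreover have "rGamma_series a n * (1 / (a * inverse (real n) + 1))
        = pochhammer a n / (fact n * exp (a * ln (real n)))
          * ((a + real n) / (a * inverse (real n) + 1))"
      by (simp add: rGamma_series_def pochhammer_rec')
    ultimately show ?case using elim
      by (simp add: sqrt_pow_def flip: a_def)
  qed
  ultimately show ?thesis
    unfolding a_def by (rule Lim_transform_eventually)
qed

text \<open>Each term of order \<open>k < j\<close> carries the vanishing factor
  \<open>n powr ((k - j) / 2)\<close>.\<close>

lemma sing_le_asymp:
  assumes "F \<in> sing_le i" "i < j"
  shows "(\<lambda>n. F $ n / (4 ^ n * real n powr (of_int j / 2 - 1))) \<longlonglongrightarrow> 0"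
  using assms(1)
proof (induction F rule: sing_le.induct)
  case (step F k c)
  have "of_int k < (of_int j :: real)" using step assms by simp
  then have "(\<lambda>n. real n powr ((of_int k - of_int j) / 2)) \<longlonglongrightarrow> 0"
    by (intro tendsto_neg_powr filterlim_real_sequentially) simp
  note zero = this
  have e: "real n powr (of_int j / 2 - 1)
      = real n powr (of_int k / 2 - 1) / real n powr ((of_int k - of_int j) / 2)" for n
    by (subst powr_diff [symmetric]) (simp add: diff_divide_distrib)
  from tendsto_mult[OF sqrt_pow_asymp[of k] zero]
  have "(\<lambda>n. sqrt_pow k $ n / (4 ^ n * real n powr (of_int j / 2 - 1))) \<longlonglongrightarrow> 0"
    by (simp add: e)
  from tendsto_add[OF step.IH tendsto_mult_left[OF this, of c]]
  show ?case by (simp add: add_divide_distrib)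
qed simp

lemma lead_asymp:
  assumes "lead F j c"
  shows "(\<lambda>n. F $ n / (4 ^ n * real n powr (of_int j / 2 - 1)))
    \<longlonglongrightarrow> c * rGamma (of_int j / 2)"
proof -
  have "F - fps_const c * sqrt_pow j \<in> sing_le (j - 1)"
    using assms by (simp add: lead_def)
  from tendsto_add[OF sing_le_asymp[OF this, of j] tendsto_mult_left[OF sqrt_pow_asymp, of c j]]
  show ?thesis by (simp add: diff_divide_distrib)
qed

section \<open>Staircase polygons as walks\<close>

abbreviation easts :: "step list \<Rightarrow> nat" where
  "easts w \<equiv> count_list w East"

lemma easts_plus_norths: "easts w + count_list w North = length w"
proof (induction w)
  case (Cons s w)
  then show ?case by (cases s) auto
qed simp

lemma easts_le_length: "easts w \<le> length w"
  using easts_plus_norths[of w] by simp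

text \<open>The \<open>k\<close>-th vertex lies on the \<open>k\<close>-th antidiagonal, so two
  paths can meet only at equal step numbers, where the east counts decide.\<close>

lemma endpoint_eq_iff: "endpoint v = endpoint w \<longleftrightarrow> length v = length w \<and> easts v = easts w"
  using easts_plus_norths[of v] easts_plus_norths[of w] by (auto simp: endpoint_def)

lemma easts_take_mono: "k \<le> n \<Longrightarrow> easts (take k w) \<le> easts (take n w)"
  by (metis count_list_append le_add1 le_add_diff_inverse take_add)

lemma less_easts_take_iff:
  "i < easts (take k w) \<longleftrightarrow> (\<exists>t<k. t < length w \<and> w ! t = East \<and> easts (take t w) = i)"
proof (induction k)
  case (Suc k)
  show ?case
  proof (cases "k < length w")
    case True
    then have "i < easts (take (Suc k) w) \<longleftrightarrow>
        i < easts (take k w) \<or> (w ! k = East \<and> easts (take k w) = i)"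
      by (auto simp: take_Suc_conv_app_nth)
    then show ?thesis using Suc True by (auto simp: less_Suc_eq)
  next
    case False
    then show ?thesis using Suc by (auto simp: less_Suc_eq)
  qed
qed simp

lemma east_edges_iff:
  "(i, a) \<in> east_edges w \<longleftrightarrow> i + a < length w \<and> w ! (i + a) = East \<and> easts (take (i + a) w) = i"
proof -
  have "endpoint (take k w) = (i, a) \<longleftrightarrow> k = i + a \<and> easts (take k w) = i" if "k < length w" for k
    using easts_plus_norths[of "take k w"] that by (auto simp: endpoint_def)
  then have "(i, a) \<in> east_edges w \<longleftrightarrow>
      (\<exists>k. (k = i + a \<and> easts (take k w) = i) \<and> k < length w \<and> w ! k = East)"
    unfolding east_edges_def mem_Collect_eq by metis
  then show ?thesis by auto
qed

lemma east_edge_at_time: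
  assumes "t < length w" "w ! t = East" "easts (take t w) = i"
  shows "i \<le> t" "(i, t - i) \<in> east_edges w"
proof -
  show "i \<le> t"
    using easts_le_length[of "take t w"] assms by simp
  then show "(i, t - i) \<in> east_edges w"
    using assms by (simp add: east_edges_iff)
qed

text \<open>The edge at \<open>(i, a)\<close> is traversed from time \<open>i + a\<close> to
  \<open>i + a + 1\<close>, so height at most \<open>j\<close> means that column \<open>i\<close>
  has been left by time \<open>i + j + 1\<close>.\<close>

lemma ex_east_edge_below_iff:
  "(\<exists>a\<le>j. (i, a) \<in> east_edges w) \<longleftrightarrow> i < easts (take (i + j + 1) w)"
proof
  assume "\<exists>a\<le>j. (i, a) \<in> east_edges w"
  then obtain a where "a \<le> j" "(i, a) \<in> east_edges w" by blast
  then show "i < easts (take (i + j + 1) w)"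
    unfolding less_easts_take_iff east_edges_iff by (intro exI[of _ "i + a"]) auto
next
  assume "i < easts (take (i + j + 1) w)"
  then obtain t where "t < i + j + 1" "t < length w" "w ! t = East" "easts (take t w) = i"
    unfolding less_easts_take_iff by blast
  with east_edge_at_time[of t w i] show "\<exists>a\<le>j. (i, a) \<in> east_edges w"
    by (intro exI[of _ "t - i"]) auto
qed

text \<open>The opposite case; \<open>i < easts w\<close> ensures that the path crosses column
  \<open>i\<close> at all.\<close>

lemma ex_east_edge_above_iff:
  "(\<exists>b\<ge>j + 1. (i, b) \<in> east_edges w) \<longleftrightarrow> easts (take (i + j + 1) w) \<le> i \<and> i < easts w"
proof
  assume "\<exists>b\<ge>j + 1. (i, b) \<in> east_edges w"
  then obtain b where b: "b \<ge> j + 1" "i + b < length w" "w ! (i + b) = East"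
      "easts (take (i + b) w) = i"
    unfolding east_edges_iff by blast
  moreover have "easts (take (i + j + 1) w) \<le> easts (take (i + b) w)"
    using b by (intro easts_take_mono) simp
  moreover have "i < easts (take (length w) w)"
    unfolding less_easts_take_iff using b by blast
  ultimately show "easts (take (i + j + 1) w) \<le> i \<and> i < easts w" by simp
next
  assume *: "easts (take (i + j + 1) w) \<le> i \<and> i < easts w"
  then have "i < easts (take (length w) w)" by simp
  then obtain t where t: "t < length w" "w ! t = East" "easts (take t w) = i"
    unfolding less_easts_take_iff by blast
  have "\<not> t < i + j + 1"
    using * t less_easts_take_iff[of i "i + j + 1" w] by auto
  with east_edge_at_time[OF t] show "\<exists>b\<ge>j + 1. (i, b) \<in> east_edges w"
    by (intro exI[of _ "t - i"]) auto
qed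

text \<open>A square \<open>(i, j)\<close> is charged to its diagonal from \<open>(i, j + 1)\<close> to \<open>(i + 1, j)\<close>, which lies on the
  line through the \<open>i + j + 1\<close>-st vertices of both paths.\<close>

lemma area_eq_sum_gaps:
  assumes "endpoint u = endpoint l"
  shows "area (u, l) = (\<Sum>k<length u. easts (take k l) - easts (take k u))"
proof -
  have eq: "length u = length l" "easts u = easts l"
    using assms by (auto simp: endpoint_eq_iff)
  have "(i, j) \<in> enclosed_squares (u, l) \<longleftrightarrow>
      easts (take (i + j + 1) u) \<le> i \<and> i < easts (take (i + j + 1) l)" for i j
  proof -
    have "(i, j) \<in> enclosed_squares (u, l) \<longleftrightarrow>
        (\<exists>a\<le>j. (i, a) \<in> east_edges l) \<and> (\<exists>b\<ge>j + 1. (i, b) \<in> east_edges u)"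
      unfolding enclosed_squares_def by auto
    also have "\<dots> \<longleftrightarrow> easts (take (i + j + 1) u) \<le> i \<and> i < easts (take (i + j + 1) l)"
      unfolding ex_east_edge_below_iff ex_east_edge_above_iff
      \<comment> \<open>Taking the prefix up to the \<open>max\<close> gives all of
        \<open>l\<close>, so \<open>easts l = easts u\<close> bounds the prefix count and yields
        \<open>i < easts u\<close>.\<close>
      using easts_take_mono[of "i + j + 1" "max (i + j + 1) (length l)" l] eq by auto
    finally show ?thesis .
  qed
  note mem = this
  \<comment> \<open>This keeps the truncated subtraction \<open>k - 1 - i\<close> below
    exact.\<close>
  have less: "i < easts (take k l) \<Longrightarrow> i < k" for i k
    using easts_le_length[of "take k l"] by simp
  have "bij_betw (\<lambda>(k, i). (i, k - 1 - i))
      (SIGMA k:{..<length u}. {easts (take k u)..<easts (take k l)}) (enclosed_squares (u, l))"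
    (is "bij_betw ?f ?S _")
  proof (rule bij_betw_byWitness[where f' = "\<lambda>(i, j). (i + j + 1, i)"])
    show "\<forall>a\<in>?S. (\<lambda>(i, j). (i + j + 1, i)) (?f a) = a"
    proof (rule ballI)
      fix a assume "a \<in> ?S"
      then obtain k i where "a = (k, i)" "i < easts (take k l)" by auto
      with less[of i k] show "(\<lambda>(i, j). (i + j + 1, i)) (?f a) = a" by simp
    qed
    show "\<forall>b\<in>enclosed_squares (u, l). ?f ((\<lambda>(i, j). (i + j + 1, i)) b) = b"
      by auto
    show "?f ` ?S \<subseteq> enclosed_squares (u, l)"
    proof (rule image_subsetI)
      fix a assume "a \<in> ?S"
      then obtain k i where a: "a = (k, i)" "easts (take k u) \<le> i" "i < easts (take k l)" by auto
      with less[of i k] have "i + (k - 1 - i) + 1 = k" by simp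
      with a show "?f a \<in> enclosed_squares (u, l)"
        by (simp add: mem del: add.right_neutral add_Suc_right)
    qed
    show "(\<lambda>(i, j). (i + j + 1, i)) ` enclosed_squares (u, l) \<subseteq> ?S"
    proof (rule image_subsetI)
      fix a assume "a \<in> enclosed_squares (u, l)"
      then obtain i j where a: "a = (i, j)" "(i, j) \<in> enclosed_squares (u, l)" by (cases a) auto
      then have *: "easts (take (i + j + 1) u) \<le> i" "i < easts (take (i + j + 1) l)"
        unfolding mem by auto
      \<comment> \<open>From the last vertex on, \<open>take\<close> returns the whole paths, whose
        east counts agree, so no square is charged there.\<close>
      moreover have "i + j + 1 < length u"
      proof (rule ccontr)
        assume "\<not> i + j + 1 < length u"
        then show False using * eq by simp
      qed
      ultimately show "(\<lambda>(i, j). (i + j + 1, i)) a \<in> ?S"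
        by (simp add: a)
    qed
  qed
  from bij_betw_same_card[OF this] show ?thesis
    by (simp add: area_def)
qed

lemma vertices_Int_iff:
  assumes "endpoint u = endpoint l"
  shows "vertices u \<inter> vertices l = {(0, 0), endpoint u} \<longleftrightarrow>
    (\<forall>k. 0 < k \<and> k < length u \<longrightarrow> easts (take k u) \<noteq> easts (take k l))"
proof -
  have eq: "length u = length l" "easts u = easts l"
    using assms by (auto simp: endpoint_eq_iff)
  have start: "(0, 0) = endpoint (take 0 w)" for w
    by (simp add: endpoint_def)
  have "endpoint (take k w) \<in> vertices w" if "k \<le> length w" for k w
    using that by (auto simp: vertices_def)
  from this[of 0] this[of "length w" w for w]
  have "{(0, 0), endpoint w} \<subseteq> vertices w" for w
    using start[of w] by simp
  from this[of u] this[of l] have "{(0, 0), endpoint u} \<subseteq> vertices u \<inter> vertices l"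
    using assms by simp
  moreover have "vertices u \<inter> vertices l \<subseteq> {(0, 0), endpoint u} \<longleftrightarrow>
    (\<forall>k. 0 < k \<and> k < length u \<longrightarrow> easts (take k u) \<noteq> easts (take k l))"
  proof (intro iffI allI impI notI)
    fix k assume sub: "vertices u \<inter> vertices l \<subseteq> {(0, 0), endpoint u}"
      and k: "0 < k \<and> k < length u" and "easts (take k u) = easts (take k l)"
    then have "endpoint (take k u) = endpoint (take k l)"
      using eq by (simp add: endpoint_eq_iff)
    moreover have "endpoint (take k w) \<in> vertices w" if "length w = length u" for w
      unfolding vertices_def using k that by auto
    ultimately have "endpoint (take k u) \<in> vertices u \<inter> vertices l"
      using eq by (metis IntI)
    with sub have "endpoint (take k u) = endpoint (take 0 u) \<or> endpoint (take k u) = endpoint u"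
      using start[of u] by (metis (no_types) insertE singletonD subsetD)
    then show False using k by (auto simp only: endpoint_eq_iff length_take)
  next
    assume *: "\<forall>k. 0 < k \<and> k < length u \<longrightarrow> easts (take k u) \<noteq> easts (take k l)"
    show "vertices u \<inter> vertices l \<subseteq> {(0, 0), endpoint u}"
    proof
      fix v assume "v \<in> vertices u \<inter> vertices l"
      then obtain k k' where k: "k \<le> length u" "v = endpoint (take k u)"
          "k' \<le> length l" "v = endpoint (take k' l)"
        unfolding vertices_def by auto
      then have "k = k'" "easts (take k u) = easts (take k' l)"
        using endpoint_eq_iff[of "take k u" "take k' l"] by auto
      then have "k = 0 \<or> k = length u"
        using * k by (metis le_neq_implies_less gr0I)
      then show "v \<in> {(0, 0), endpoint u}"
        using k start by auto
    qed
  qed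
  ultimately show ?thesis by blast
qed

text \<open>A pair of paths is read as the walk performed by the distance of their \<open>k\<close>-th vertices,
  measured along the antidiagonal.\<close>

fun gap_step :: "step \<times> step \<Rightarrow> nat \<Rightarrow> nat" where
  "gap_step (North, East) h = h + 1"
| "gap_step (East, North) h = h - 1"
| "gap_step _ h = h"

text \<open>The height must be positive before every step, so the walk ends at its first visit of 0
  and the subtraction in \<open>gap_step\<close> is never truncated.\<close>

primrec walk :: "(step \<times> step) list \<Rightarrow> nat \<Rightarrow> bool" where
  "walk [] h \<longleftrightarrow> h = 0"
| "walk (s # w) h \<longleftrightarrow> h > 0 \<and> walk w (gap_step s h)"

primrec walk_area :: "(step \<times> step) list \<Rightarrow> nat \<Rightarrow> nat" where
  "walk_area [] h = 0"
| "walk_area (s # w) h = h + walk_area w (gap_step s h)"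

lemma gap_step_easts:
  "h > 0 \<Longrightarrow> gap_step s h + easts [fst s] = h + easts [snd s]"
  by (induction s h rule: gap_step.induct) auto

text \<open>Heights change by at most 1 per step, so a walk that avoids 0 before its end stays
  positive. The index \<open>k = 0\<close> encodes that \<open>h > 0\<close> unless \<open>w\<close>
  is empty.\<close>

lemma walk_iff:
  "walk w h \<longleftrightarrow> h + easts (map snd w) = easts (map fst w) \<and>
    (\<forall>k<length w. h + easts (take k (map snd w)) \<noteq> easts (take k (map fst w)))"
proof (induction w arbitrary: h)
  case (Cons s w)
  show ?case
  proof (cases "h = 0")
    case False
    then have "gap_step s h + easts [fst s] = h + easts [snd s]"
      by (intro gap_step_easts) simp
    then have "gap_step s h + easts v = easts v' \<longleftrightarrow> h + easts (snd s # v) = easts (fst s # v')" for v v'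
      by (auto split: if_splits)
    then show ?thesis using False
      by (simp add: Cons All_less_Suc2 del: count_list.simps(2))
  qed (auto intro!: exI[of _ 0])
qed simp

lemma walk_area_eq:
  "walk w h \<Longrightarrow> walk_area w h =
    (\<Sum>k<length w. h + easts (take k (map snd w)) - easts (take k (map fst w)))"
proof (induction w arbitrary: h)
  case (Cons s w)
  then have "gap_step s h + easts [fst s] = h + easts [snd s]"
    by (intro gap_step_easts) simp
  then have "gap_step s h + easts v - easts v' = h + easts (snd s # v) - easts (fst s # v')" for v v'
    by (auto split: if_splits)
  then show ?case using Cons by (simp add: sum.lessThan_Suc_shift del: sum.lessThan_Suc count_list.simps(2))
qed simp

section \<open>The bijection between walks and polygons\<close>

definition walks :: "nat \<Rightarrow> nat \<Rightarrow> (step \<times> step) list set" where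
  "walks n h = {w. length w = n \<and> walk w h}"

definition polygons :: "nat \<Rightarrow> (step list \<times> step list) set" where
  "polygons m = {p. staircase_polygon p \<and> half_perimeter p = m}"

text \<open>The first pair of steps is forced. It leads to height 1, and \<open>n\<close> further
  pairs give half-perimeter \<open>n + 1\<close>.\<close>

definition polygon_of_walk :: "(step \<times> step) list \<Rightarrow> step list \<times> step list" where
  "polygon_of_walk w = (North # map fst w, East # map snd w)"

lemma endpoint_polygon_of_walk:
  assumes "walk w 1"
  shows "endpoint (North # map fst w) = endpoint (East # map snd w)"
  using assms by (simp add: walk_iff endpoint_eq_iff)

lemma staircase_polygon_of_walk_iff:
  "staircase_polygon (polygon_of_walk w) \<longleftrightarrow> walk w 1"
proof (cases "endpoint (North # map fst w) = endpoint (East # map snd w)")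
  case True
  then show ?thesis
    unfolding staircase_polygon_def polygon_of_walk_def walk_iff
    by (simp add: vertices_Int_iff endpoint_eq_iff All_less_Suc2 gr0_conv_Suc) (fastforce simp: less_Suc_eq_0_disj)
next
  case False
  then show ?thesis
    using endpoint_polygon_of_walk by (auto simp: staircase_polygon_def polygon_of_walk_def)
qed

text \<open>The sum of gaps starts with the common initial vertex, whose gap is 0; the other gaps
  are the heights of the walk.\<close>

lemma area_polygon_of_walk:
  assumes "walk w 1"
  shows "area (polygon_of_walk w) = walk_area w 1"
  using assms unfolding polygon_of_walk_def area_eq_sum_gaps[OF endpoint_polygon_of_walk[OF assms]]
  by (simp add: walk_area_eq sum.lessThan_Suc_shift del: sum.lessThan_Suc)

lemma bij_betw_polygon_of_walk: "bij_betw polygon_of_walk (walks n 1) (polygons (Suc n))"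
proof (rule bij_betwI')
  fix w w' assume "w \<in> walks n 1" "w' \<in> walks n 1"
  show "polygon_of_walk w = polygon_of_walk w' \<longleftrightarrow> w = w'"
    by (auto simp: polygon_of_walk_def intro: pair_list_eqI)
next
  fix w assume "w \<in> walks n 1"
  then show "polygon_of_walk w \<in> polygons (Suc n)"
    by (auto simp: polygons_def walks_def staircase_polygon_of_walk_iff)
      (simp add: polygon_of_walk_def half_perimeter_def)
next
  fix p assume p: "p \<in> polygons (Suc n)"
  obtain u l where ul: "p = (u, l)" by force
  with p have "staircase_polygon (u, l)" "half_perimeter (u, l) = Suc n"
    by (auto simp: polygons_def)
  then have "u = North # tl u" "l = East # tl l" "length u = Suc n" "length l = Suc n"
    by (auto simp: staircase_polygon_def half_perimeter_def endpoint_eq_iff neq_Nil_conv)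
  then have w: "p = polygon_of_walk (zip (tl u) (tl l))" "length (zip (tl u) (tl l)) = n"
    by (auto simp: ul polygon_of_walk_def)
  with p have "zip (tl u) (tl l) \<in> walks n 1"
    by (simp add: walks_def polygons_def staircase_polygon_of_walk_iff)
  with w show "\<exists>w\<in>walks n 1. p = polygon_of_walk w" by blast
qed

lemma UNIV_step: "(UNIV :: step set) = {North, East}"
  using step.exhaust by auto

lemma finite_walks: "finite (walks n h)"
proof (rule finite_subset)
  show "walks n h \<subseteq> {w. set w \<subseteq> UNIV \<and> length w = n}"
    by (auto simp: walks_def)
  show "finite {w :: (step \<times> step) list. set w \<subseteq> UNIV \<and> length w = n}"
    by (intro finite_lists_length_eq finite_prod[THEN iffD2]) (simp add: UNIV_step flip: UNIV_Times_UNIV)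
qed

text \<open>A series in \<open>s\<close>: a walk of area \<open>a\<close> has weight
  \<open>q^a\<close> with \<open>q = exp s\<close>, so its coefficients are
  \<open>a^k / k!\<close>.\<close>

definition walk_gf :: "nat \<Rightarrow> nat \<Rightarrow> real fps" where
  "walk_gf n h = (\<Sum>w\<in>walks n h. fps_exp (real (walk_area w h)))"

lemma walk_gf_height_0: "walk_gf n 0 = (if n = 0 then 1 else 0)"
proof -
  have "walks n 0 = (if n = 0 then {[]} else {})"
    by (auto simp: walks_def length_Suc_conv gr0_conv_Suc)
  then show ?thesis by (simp add: walk_gf_def)
qed

lemma walk_gf_length_0: "walk_gf 0 (Suc h) = 0"
  by (simp add: walk_gf_def walks_def)

text \<open>The first step is split off; the factor 2 counts the two pairs of equal steps.\<close>

lemma walk_gf_Suc: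
  "walk_gf (Suc n) (Suc h) =
     fps_exp (real (Suc h)) * (walk_gf n (h + 2) + 2 * walk_gf n (h + 1) + walk_gf n h)"
proof -
  have "walks (Suc n) (Suc h) = (\<lambda>(s, w). s # w) ` (SIGMA s:UNIV. walks n (gap_step s (Suc h)))"
    by (auto simp: walks_def length_Suc_conv image_iff)
  then have "walk_gf (Suc n) (Suc h) =
      (\<Sum>(s, w)\<in>(SIGMA s:UNIV. walks n (gap_step s (Suc h))).
        fps_exp (real (Suc h)) * fps_exp (real (walk_area w (gap_step s (Suc h)))))"
    by (auto simp: walk_gf_def sum.reindex inj_on_def fps_exp_add_mult[symmetric] add_ac intro!: sum.cong)
  also have "\<dots> = (\<Sum>s\<in>UNIV. fps_exp (real (Suc h)) * walk_gf n (gap_step s (Suc h)))"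
    by (subst sum.Sigma[symmetric])
      (simp_all add: finite_walks walk_gf_def sum_distrib_left UNIV_step flip: UNIV_Times_UNIV)
  also have "\<dots> = fps_exp (real (Suc h)) * (walk_gf n (h + 2) + 2 * walk_gf n (h + 1) + walk_gf n h)"
    by (simp add: UNIV_step algebra_simps flip: UNIV_Times_UNIV)
  finally show ?thesis .
qed

section \<open>The functional equation\<close>

definition dilate :: "'a \<Rightarrow> 'a fps \<Rightarrow> 'a :: comm_ring_1 fps" where
  "dilate c F = Abs_fps (\<lambda>n. c ^ n * F $ n)"

lemma dilate_nth: "dilate c F $ n = c ^ n * F $ n"
  by (simp add: dilate_def)

lemma dilate_add: "dilate c (F + G) = dilate c F + dilate c G"
  by (rule fps_ext) (simp add: dilate_nth algebra_simps)

lemma dilate_mult: "dilate c (F * G) = dilate c F * dilate c G"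
proof (rule fps_ext)
  fix n
  have "dilate c (F * G) $ n = (\<Sum>i=0..n. c ^ (i + (n - i)) * (F $ i * G $ (n - i)))"
    by (simp add: dilate_nth fps_mult_nth sum_distrib_left)
  then show "dilate c (F * G) $ n = (dilate c F * dilate c G) $ n"
    unfolding power_add by (simp add: dilate_nth fps_mult_nth mult_ac)
qed

lemma dilate_const: "dilate c (fps_const a) = fps_const a"
  by (rule fps_ext) (simp add: dilate_nth)

lemma dilate_X: "dilate c fps_X = fps_const c * fps_X"
  by (rule fps_ext) (auto simp: dilate_nth le_Suc_eq)

lemma dilate_one: "dilate c 1 = 1"
  by (rule fps_ext) (simp add: dilate_nth)

lemma dilate_numeral: "dilate c (numeral k) = numeral k"
  unfolding numeral_fps_const by (rule dilate_const)

lemma dilate_dilate: "dilate a (dilate b F) = dilate (a * b) F"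
  by (rule fps_ext) (simp add: dilate_nth power_mult_distrib mult_ac)

lemma dilate_1: "dilate 1 F = F"
  by (rule fps_ext) (simp add: dilate_nth)

text \<open>The generating functions of walks from height \<open>h\<close> to their first visit of \<open>0\<close> are determined
  by the decomposition at the first step, and the products below solve the same system.\<close>

lemma first_step_unique:
  fixes V W :: "nat \<Rightarrow> 'a :: comm_ring_1 fps"
  assumes "V 0 = 1" "\<And>h. V (Suc h) =
      fps_X * (fps_const (q ^ Suc h) * (V (Suc (Suc h)) + V (Suc h) + V (Suc h) + V h))"
    and "W 0 = 1" "\<And>h. W (Suc h) =
      fps_X * (fps_const (q ^ Suc h) * (W (Suc (Suc h)) + W (Suc h) + W (Suc h) + W h))"
  shows "V = W"
proof -
  have "V h $ n = W h $ n" for h n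
  proof (induction n arbitrary: h)
    case 0
    show ?case
    proof (cases h)
      case (Suc k)
      show ?thesis
        unfolding Suc by (subst assms(2), subst assms(4)) simp
    qed (simp add: assms(1,3))
  next
    case (Suc n)
    note IH = Suc.IH
    show ?case
    proof (cases h)
      case (Suc k)
      show ?thesis
        unfolding Suc by (subst assms(2), subst assms(4)) (simp add: IH)
    qed (simp add: assms(1,3))
  qed
  then show ?thesis by (auto simp: fps_eq_iff)
qed

text \<open>The coefficient recursion of \<open>D(x) = q x (D(x) D(q x) + 2 D(x) + 1)\<close>, which
  makes the existence of a solution \<open>D\<close> explicit.\<close>

fun passage_coeff :: "'a \<Rightarrow> nat \<Rightarrow> 'a :: comm_ring_1" where
  "passage_coeff q 0 = 0"
| "passage_coeff q (Suc n) = q * ((\<Sum>j=0..n. passage_coeff q j * (q ^ (n - j) * passage_coeff q (n - j)))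
     + passage_coeff q n + passage_coeff q n + (if n = 0 then 1 else 0))"

definition passage :: "'a \<Rightarrow> 'a :: comm_ring_1 fps" where
  "passage q = Abs_fps (passage_coeff q)"

lemma passage_eq:
  "passage q = fps_X * (fps_const q *
     (passage q * dilate q (passage q) + passage q + passage q + 1))"
proof (rule fps_ext)
  fix n
  define B where "B = passage q * dilate q (passage q)"
  have B: "B $ n = (\<Sum>j=0..n. passage_coeff q j * (q ^ (n - j) * passage_coeff q (n - j)))" for n
    by (simp add: B_def passage_def dilate_nth fps_mult_nth)
  have "passage q $ n = (fps_X * (fps_const q * (B + passage q + passage q + 1))) $ n"
    by (cases n) (simp_all add: B passage_def numeral_fps_const)
  then show "passage q $ n = (fps_X * (fps_const q *
     (passage q * dilate q (passage q) + passage q + passage q + 1))) $ n"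
    by (simp only: B_def)
qed

text \<open>A walk from height \<open>h\<close> to 0 descends one level at a time. The descent from
  \<open>j + 1\<close> to \<open>j\<close> is a walk from 1 to 0 lifted by \<open>j\<close>, which
  adds \<open>j\<close> to the area at each step; hence the factors \<open>D(q^j x)\<close> of
  \<open>V h\<close>, with \<open>D = passage q\<close>.\<close>

lemma first_step_solution:
  assumes "W 0 = 1" "\<And>h. W (Suc h) =
      fps_X * (fps_const (q ^ Suc h) * (W (Suc (Suc h)) + W (Suc h) + W (Suc h) + W h))"
  shows "W 1 = passage q"
proof -
  define V where "V h = (\<Prod>j<h. dilate (q ^ j) (passage q))" for h
  have "V (Suc h) =
      fps_X * (fps_const (q ^ Suc h) * (V (Suc (Suc h)) + V (Suc h) + V (Suc h) + V h))" for h
  proof -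
    define D D' where "D = dilate (q ^ h) (passage q)" and "D' = dilate (q ^ Suc h) (passage q)"
    \<comment> \<open>The equation of \<open>passage q\<close>, taken at
      \<open>q^h x\<close>.\<close>
    have "D = dilate (q ^ h) (fps_X * (fps_const q *
     (passage q * dilate q (passage q) + passage q + passage q + 1)))"
      by (simp only: D_def flip: passage_eq)
    also have "\<dots> = fps_X * (fps_const (q ^ Suc h) * (D * D' + D + D + 1))"
      by (simp add: D_def D'_def dilate_mult dilate_add dilate_const dilate_X dilate_dilate dilate_one
          dilate_numeral           mult_ac del: fps_const_mult flip: fps_const_mult)
    finally have "V h * D = V h * (fps_X * (fps_const (q ^ Suc h) * (D * D' + D + D + 1)))"
      by (rule arg_cong)
    also have "\<dots> = fps_X * (fps_const (q ^ Suc h) * (V h * D * D' + V h * D + V h * D + V h))"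
      by (simp add: algebra_simps)
    finally show ?thesis
      by (simp only: V_def D_def D'_def prod.lessThan_Suc)
  qed
  moreover have "V 0 = 1"
    by (simp add: V_def)
  ultimately have "V = W"
    using assms by (intro first_step_unique[of V q W]) auto
  moreover have "V 1 = passage q"
    by (simp add: V_def dilate_1)
  ultimately show ?thesis by simp
qed

text \<open>This is \<open>P(x, exp s)\<close> with outer variable \<open>x\<close> and inner
  variable \<open>s\<close>.\<close>

definition polygon_gf :: "real fps fps" where
  "polygon_gf = Abs_fps (\<lambda>m. \<Sum>p\<in>polygons m. fps_exp (real (area p)))"

lemma polygons_0: "polygons 0 = {}"
proof -
  have "(length u + length l) div 2 \<noteq> 0" if "u \<noteq> []" "l \<noteq> []" for u l :: "step list"
    using that by (cases u; cases l) auto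
  then show ?thesis
    by (auto simp: polygons_def staircase_polygon_def half_perimeter_def)
qed

lemma sum_polygons_Suc: "(\<Sum>p\<in>polygons (Suc n). f (area p)) = (\<Sum>w\<in>walks n 1. f (walk_area w 1))"
proof -
  have "(\<Sum>w\<in>walks n 1. f (walk_area w 1)) = (\<Sum>w\<in>walks n 1. f (area (polygon_of_walk w)))"
    by (intro sum.cong) (auto simp: area_polygon_of_walk walks_def)
  then show ?thesis
    using sum.reindex_bij_betw[OF bij_betw_polygon_of_walk, of "\<lambda>p. f (area p)" n] by simp
qed

lemma finite_polygons: "finite (polygons m)"
proof (cases m)
  case (Suc n)
  then show ?thesis
    using bij_betw_finite[OF bij_betw_polygon_of_walk, of n] finite_walks[of n 1] by simp
qed (simp add: polygons_0)

text \<open>The factor \<open>x\<close> accounts for the forced first pair of steps.\<close>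

lemma polygon_gf_eq_passage: "polygon_gf = fps_X * passage (fps_exp 1)"
proof -
  define W where "W h = Abs_fps (\<lambda>n. walk_gf n h)" for h
  have "W 1 = passage (fps_exp 1)"
  proof (rule first_step_solution)
    show "W 0 = 1"
      by (rule fps_ext) (simp add: W_def walk_gf_height_0)
    fix h
    show "W (Suc h) =
        fps_X * (fps_const (fps_exp 1 ^ Suc h) * (W (Suc (Suc h)) + W (Suc h) + W (Suc h) + W h))"
      (is "_ = ?R")
    proof (rule fps_ext)
      fix n
      show "W (Suc h) $ n = ?R $ n"
        by (cases n) (simp_all add: W_def walk_gf_length_0 walk_gf_Suc fps_exp_power_mult algebra_simps
            del: power_Suc)
    qed
  qed
  moreover have "polygon_gf $ m = (fps_X * W 1) $ m" for m
    by (cases m) (simp_all add: polygon_gf_def W_def polygons_0 walk_gf_def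
        sum_polygons_Suc[of "\<lambda>a. fps_exp (real a)"])
  ultimately show ?thesis
    by (auto simp: fps_eq_iff)
qed

text \<open>The equation \<open>P(x, q) = x^2 q / (1 - 2 x q - P(q x, q))\<close> with its
  denominator cleared.\<close>

lemma polygon_gf_eq:
  "polygon_gf = fps_const (fps_exp 1) * fps_X ^ 2 + fps_const (fps_exp 1) * (2 * fps_X * polygon_gf)
     + polygon_gf * dilate (fps_exp 1) polygon_gf"
proof -
  let ?q = "fps_exp 1 :: real fps" and ?D = "passage (fps_exp 1) :: real fps fps"
  have "polygon_gf = fps_X * (fps_X * (fps_const ?q * (?D * dilate ?q ?D + ?D + ?D + 1)))"
    by (simp only: polygon_gf_eq_passage flip: passage_eq)
  also have "\<dots> = fps_const ?q * fps_X ^ 2 + fps_const ?q * (2 * fps_X * polygon_gf)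
     + polygon_gf * dilate ?q polygon_gf"
    by (simp add: polygon_gf_eq_passage dilate_mult dilate_X algebra_simps power2_eq_square)
  finally show ?thesis .
qed

section \<open>Expansion in powers of \<open>s\<close>\<close>

definition inner_coeff :: "nat \<Rightarrow> real fps fps \<Rightarrow> real fps" where
  "inner_coeff k P = Abs_fps (\<lambda>m. P $ m $ k)"

lemma inner_coeff_nth: "inner_coeff k P $ m = P $ m $ k"
  by (simp add: inner_coeff_def)

lemma inner_coeff_add: "inner_coeff k (P + Q) = inner_coeff k P + inner_coeff k Q"
  by (rule fps_ext) (simp add: inner_coeff_nth)

lemma inner_coeff_mult:
  "inner_coeff k (P * Q) = (\<Sum>i\<le>k. inner_coeff i P * inner_coeff (k - i) Q)"
proof (rule fps_ext)
  fix m
  have "inner_coeff k (P * Q) $ m = (\<Sum>j=0..m. \<Sum>i=0..k. P $ j $ i * Q $ (m - j) $ (k - i))"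
    by (simp add: inner_coeff_nth fps_mult_nth fps_sum_nth)
  also have "\<dots> = (\<Sum>i=0..k. \<Sum>j=0..m. P $ j $ i * Q $ (m - j) $ (k - i))"
    by (rule sum.swap)
  finally show "inner_coeff k (P * Q) $ m = (\<Sum>i\<le>k. inner_coeff i P * inner_coeff (k - i) Q) $ m"
    by (simp add: fps_sum_nth fps_mult_nth inner_coeff_nth atLeast0AtMost)
qed

lemma inner_coeff_fps_const: "inner_coeff k (fps_const a) = fps_const (a $ k)"
  by (rule fps_ext) (simp add: inner_coeff_nth)

lemma inner_coeff_X_mult: "inner_coeff k (fps_X * P) = fps_X * inner_coeff k P"
  by (rule fps_ext) (simp add: inner_coeff_nth)

text \<open>Dilation multiplies the coefficient of \<open>x^m\<close> by \<open>exp (m s)\<close>,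
  which expands into \<open>m^i / i!\<close>, and \<open>theta ^^ i\<close> multiplies by
  \<open>m^i\<close>.\<close>

lemma inner_coeff_dilate_exp:
  "inner_coeff k (dilate (fps_exp 1) P) =
    (\<Sum>i\<le>k. fps_const (1 / fact i) * (theta ^^ i) (inner_coeff (k - i) P))"
proof (rule fps_ext)
  fix m
  have "inner_coeff k (dilate (fps_exp 1) P) $ m = (fps_exp (real m) * P $ m) $ k"
    by (simp add: inner_coeff_nth dilate_nth fps_exp_power_mult)
  also have "\<dots> = (\<Sum>i\<le>k. real m ^ i / fact i * P $ m $ (k - i))"
    by (simp add: fps_mult_nth atLeast0AtMost)
  finally show "inner_coeff k (dilate (fps_exp 1) P) $ m =
      (\<Sum>i\<le>k. fps_const (1 / fact i) * (theta ^^ i) (inner_coeff (k - i) P)) $ m"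
    by (simp add: fps_sum_nth theta_funpow_nth inner_coeff_nth)
qed

definition area_moment :: "nat \<Rightarrow> real fps" where
  "area_moment k = inner_coeff k polygon_gf"

lemma area_moment_nth: "area_moment k $ m = (\<Sum>p\<in>polygons m. real (area p) ^ k) / fact k"
  by (simp add: area_moment_def inner_coeff_nth polygon_gf_def fps_sum_nth sum_divide_distrib)

text \<open>The coefficient of \<open>s^k\<close> in \<open>P(q x, q)\<close>.\<close>

definition dilated_moment :: "nat \<Rightarrow> real fps" where
  "dilated_moment k = (\<Sum>i\<le>k. fps_const (1 / fact i) * (theta ^^ i) (area_moment (k - i)))"

lemma area_moment_eq:
  "area_moment k = fps_const (1 / fact k) * fps_X ^ 2
     + 2 * fps_X * (\<Sum>i\<le>k. fps_const (1 / fact i) * area_moment (k - i))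
     + (\<Sum>i\<le>k. area_moment i * dilated_moment (k - i))"
proof -
  have X2: "inner_coeff k (fps_X ^ 2) = (if k = 0 then fps_X ^ 2 else 0)" for k
    by (rule fps_ext) (auto simp: inner_coeff_nth fps_X_power_nth)
  have "inner_coeff k (2 * fps_X * P) = 2 * fps_X * inner_coeff k P" for k P
    by (simp only: mult_2 distrib_right inner_coeff_add inner_coeff_X_mult)
  note two_X = this
  have "area_moment k = inner_coeff k (fps_const (fps_exp 1) * fps_X ^ 2)
      + inner_coeff k (fps_const (fps_exp 1) * (2 * fps_X * polygon_gf))
      + inner_coeff k (polygon_gf * dilate (fps_exp 1) polygon_gf)"
    by (simp only: area_moment_def flip: polygon_gf_eq inner_coeff_add)
  also have "inner_coeff k (fps_const (fps_exp 1) * fps_X ^ 2) = fps_const (1 / fact k) * fps_X ^ 2"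
  proof -
    have "inner_coeff k (fps_const (fps_exp 1) * fps_X ^ 2) =
        (\<Sum>i\<le>k. if i = k then fps_const (1 / fact k) * fps_X ^ 2 else 0)"
      unfolding inner_coeff_mult inner_coeff_fps_const X2 by (rule sum.cong) auto
    then show ?thesis by simp
  qed
  also have "inner_coeff k (fps_const (fps_exp 1) * (2 * fps_X * polygon_gf)) =
      2 * fps_X * (\<Sum>i\<le>k. fps_const (1 / fact i) * area_moment (k - i))"
    unfolding inner_coeff_mult[of _ "fps_const _"] inner_coeff_fps_const two_X sum_distrib_left
    by (simp add: area_moment_def mult_ac)
  also have "inner_coeff k (polygon_gf * dilate (fps_exp 1) polygon_gf) =
      (\<Sum>i\<le>k. area_moment i * dilated_moment (k - i))"
    unfolding inner_coeff_mult inner_coeff_dilate_exp dilated_moment_def area_moment_def ..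
  finally show ?thesis .
qed

section \<open>Singular expansion of the area moments\<close>

lemma dilated_moment_0: "dilated_moment 0 = area_moment 0"
  by (simp add: dilated_moment_def)

lemma area_moment_0_at_0: "area_moment 0 $ 0 = 0"
  by (simp add: area_moment_nth polygons_0)

text \<open>For \<open>k = 0\<close> the functional equation is quadratic with discriminant
  \<open>1 - 4x\<close>.\<close>

lemma two_area_moment_0: "2 * area_moment 0 = 1 - 2 * fps_X - sqrt_pow (-1)"
proof -
  define F y where "F = area_moment 0" and "y = sqrt_pow (-1)"
  have F: "F = fps_X ^ 2 + 2 * fps_X * F + F * F"
    using area_moment_eq[of 0] by (simp add: dilated_moment_0 F_def)
  have y: "y * y = 1 - 4 * fps_X"
    by (simp add: y_def sqrt_pow_mult sqrt_pow_minus_2)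
  have "(2 * F - (1 - 2 * fps_X) - y) * (2 * F - (1 - 2 * fps_X) + y)
      = 4 * (fps_X ^ 2 + 2 * fps_X * F + F * F - F) + (1 - 4 * fps_X - y * y)"
    by (simp add: algebra_simps power2_eq_square)
  also have "\<dots> = 0"
    using F y by simp
  finally have "2 * F - (1 - 2 * fps_X) - y = 0 \<or> 2 * F - (1 - 2 * fps_X) + y = 0"
    by simp
  \<comment> \<open>The constant term selects the branch: here it is -2.\<close>
  moreover have "(2 * F - (1 - 2 * fps_X) - y) $ 0 \<noteq> 0"
    by (simp add: F_def area_moment_0_at_0 y_def sqrt_pow_def)
  ultimately have "2 * F - (1 - 2 * fps_X) + y = 0"
    by auto
  then show ?thesis
    by (simp add: F_def y_def algebra_simps)
qed

text \<open>Removing the constant term \<open>1/4\<close> makes the order of the singularity of the zeroth moment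
  fit the pattern of the higher ones.\<close>

definition centred_moment :: "nat \<Rightarrow> real fps" where
  "centred_moment k = area_moment k - (if k = 0 then fps_const (1/4) else 0)"

lemma area_moment_0: "area_moment 0 = fps_const (1/4) + centred_moment 0"
  by (simp add: centred_moment_def)

lemma area_moment_pos: "0 < k \<Longrightarrow> area_moment k = centred_moment k"
  by (simp add: centred_moment_def)

text \<open>In terms of \<open>y\<close>, the zeroth moment is
  \<open>1/4 - y/2 + y^2/4\<close>.\<close>

lemma lead_centred_moment_0: "lead (centred_moment 0) (-1) (-1/2)"
proof -
  have "area_moment 0 = fps_const (1/2) * (2 * area_moment 0)"
    by (rule fps_ext) (simp add: numeral_fps_const)
  also have "\<dots> = fps_const (1/2) * (1 - 2 * fps_X - sqrt_pow (-1))"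
    by (simp only: two_area_moment_0)
  also have "\<dots> = fps_const (1/4) - fps_const (1/2) * sqrt_pow (-1) + fps_const (1/4) * (1 - 4 * fps_X)"
    by (rule fps_ext) (simp add: numeral_fps_const algebra_simps)
  finally have "centred_moment 0 - fps_const (-1/2) * sqrt_pow (-1) = fps_const (1/4) * sqrt_pow (-2)"
    by (simp add: fps_eq_iff centred_moment_def sqrt_pow_minus_2)
  then show ?thesis
    unfolding lead_def using sing_le_sqrt_pow[of "-2" "-1 - 1" "1/4"] by simp
qed

lemma theta_funpow_centred_moment:
  "0 < i \<Longrightarrow> (theta ^^ i) (area_moment k) = (theta ^^ i) (centred_moment k)"
  by (rule fps_ext) (simp add: theta_funpow_nth centred_moment_def)

text \<open>The summand with \<open>theta ^^ i\<close> has order at most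
  \<open>3 (l - i) - 1 + 2 i = 3 l - 1 - i\<close>. The subtraction removes \<open>i = 0\<close>, so
  \<open>i = 1\<close> dominates.\<close>

lemma lead_dilated_moment_diff:
  assumes "0 < l" and IH: "\<And>j. j < l \<Longrightarrow> lead (centred_moment j) (3 * int j - 1) (f j)"
  shows "lead (dilated_moment l - area_moment l) (3 * int l - 2) ((3 * real l - 4) / 2 * f (l - 1))"
proof -
  define T where "T i = fps_const (1 / fact i) * (theta ^^ i) (area_moment (l - i))" for i
  have "{..l} = insert 0 (insert 1 {2..l})"
    using assms(1) by auto
  then have eq: "dilated_moment l - area_moment l = T 1 + (\<Sum>i=2..l. T i)"
    by (simp add: dilated_moment_def T_def)
  have "T 1 = theta (centred_moment (l - 1))"
    using theta_funpow_centred_moment[of 1 "l - 1"] by (simp add: T_def)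
  moreover have "lead (theta (centred_moment (l - 1))) (3 * int l - 2) ((3 * real l - 4) / 2 * f (l - 1))"
    using lead_theta[OF IH[of "l - 1"]] assms(1) by (simp add: of_nat_diff algebra_simps)
  moreover have "T i \<in> sing_le (3 * int l - 3)" if i: "i \<in> {2..l}" for i
  proof -
    have "centred_moment (l - i) \<in> sing_le (3 * int (l - i) - 1)"
      using i by (intro lead_sing_le[OF IH]) auto
    from sing_le_theta_funpow[OF this, of i] have
        "(theta ^^ i) (area_moment (l - i)) \<in> sing_le (3 * int l - 3)"
      using i by (subst theta_funpow_centred_moment) (auto simp: of_nat_diff elim!: sing_le_mono)
    then show ?thesis
      unfolding T_def by (rule sing_le_scale)
  qed
  then have "lead (\<Sum>i=2..l. T i) (3 * int l - 2) 0"
    by (intro lead_small[OF sing_le_sum]) auto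
  ultimately show ?thesis
    using lead_add[of "T 1" "3 * int l - 2" _ "\<Sum>i=2..l. T i" 0] by (simp add: eq)
qed

text \<open>Collecting the \<open>k\<close>-th moment on one side of \<open>area_moment_eq\<close>
  gives it the factor \<open>1 - 2x - 2 area_moment 0 = y\<close>. The other side involves only
  lower moments and has order \<open>3k - 2\<close>; division by \<open>y\<close> adds one.\<close>

lemma lead_centred_moment:
  "lead (centred_moment k) (3 * int k - 1) (airy_phi k / (2 * 4 ^ k))"
proof (induction k rule: less_induct)
  case (less k)
  define f where "f k = airy_phi k / (2 * 4 ^ k)" for k
  note IH = less.IH[folded f_def]
  show ?case
  proof (cases k)
    case 0
    then show ?thesis using lead_centred_moment_0 by simp
  next
    case (Suc n)
    \<comment> \<open>Here the constant \<open>1/4\<close> dominates, so the uncentred zeroth moment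
      has order 0 rather than -1.\<close>
    have lead_F0: "lead (area_moment 0) 0 (1/4)"
      using lead_add[OF lead_small[OF lead_sing_le[OF lead_centred_moment_0], of 0], of "fps_const (1/4)" "1/4"]
        lead_mult[OF lead_small, of _ _ 0]
      by (simp add: area_moment_0 add.commute lead_def sqrt_pow_0 sing_le.zero)
    have lead_diff: "lead (dilated_moment l - area_moment l) (3 * int l - 2)
        ((3 * real l - 4) / 2 * f (l - 1))" if "0 < l" "l \<le> k" for l
      using that IH by (intro lead_dilated_moment_diff) auto
    have lead_area: "lead (area_moment l) (3 * int l - 1) (f l)" if "0 < l" "l < k" for l
      using IH[of l] that by (simp add: area_moment_pos)
    have lead_dilated: "lead (dilated_moment l) (3 * int l - 1) (f l)" if "0 < l" "l < k" for l
      using lead_add[OF lead_area[of l] lead_small[OF lead_sing_le[OF lead_diff[of l]]]] that by simp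
    \<comment> \<open>The terms too small to affect the leading coefficient; the sum omits
      \<open>i = 0\<close>, which contains the unknown moment.\<close>
    define R where "R = fps_const (1 / fact k) * fps_X ^ 2
        + 2 * fps_X * (\<Sum>i=1..k. fps_const (1 / fact i) * area_moment (k - i))"
    have area_le: "area_moment j \<in> sing_le (3 * int k - 3)" if "j < k" for j
    proof (cases "j = 0")
      case True
      then show ?thesis using lead_sing_le[OF lead_F0] Suc by (auto elim!: sing_le_mono)
    next
      case False
      then show ?thesis using lead_sing_le[OF lead_area[of j]] that by (auto elim!: sing_le_mono)
    qed
    have "fps_const (1 / fact k) * fps_X ^ 2 \<in> sing_le (3 * int k - 3)"
      using sing_le_mult[OF sing_le_X[of 0] sing_le_X[of 0]] Suc
      by (intro sing_le_scale) (auto simp: power2_eq_square elim!: sing_le_mono)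
    moreover have "2 * fps_X * (\<Sum>i=1..k. fps_const (1 / fact i) * area_moment (k - i))
        \<in> sing_le (0 + (3 * int k - 3))"
    proof (rule sing_le_mult)
      show "2 * fps_X \<in> sing_le 0"
        using sing_le_scale[OF sing_le_X[of 0], of 2] by (simp add: numeral_fps_const)
      show "(\<Sum>i=1..k. fps_const (1 / fact i) * area_moment (k - i)) \<in> sing_le (3 * int k - 3)"
        by (intro sing_le_sum sing_le_scale area_le) auto
    qed
    ultimately have "R \<in> sing_le (3 * int k - 3)"
      unfolding R_def by (intro sing_le_add) auto
    then have lead_R: "lead R (3 * int k - 2) 0"
      by (rule lead_small) simp
    have "lead (area_moment 0 * (dilated_moment k - area_moment k)) (0 + (3 * int k - 2))
        (1/4 * ((3 * real k - 4) / 2 * f (k - 1)))"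
      using Suc by (intro lead_mult lead_F0 lead_diff) auto
    moreover have "lead (\<Sum>i=1..n. area_moment i * dilated_moment (k - i)) (3 * int k - 2)
        (\<Sum>i=1..n. f i * f (k - i))"
    proof (rule lead_sum)
      fix i assume i: "i \<in> {1..n}"
      with Suc have "lead (area_moment i * dilated_moment (k - i))
          ((3 * int i - 1) + (3 * int (k - i) - 1)) (f i * f (k - i))"
        by (intro lead_mult lead_area lead_dilated) auto
      moreover have "(3 * int i - 1) + (3 * int (k - i) - 1) = 3 * int k - 2"
        using i Suc by (simp add: of_nat_diff)
      ultimately show "lead (area_moment i * dilated_moment (k - i)) (3 * int k - 2) (f i * f (k - i))"
        by simp
    qed
    ultimately have "lead (R + (area_moment 0 * (dilated_moment k - area_moment k)
          + (\<Sum>i=1..n. area_moment i * dilated_moment (k - i)))) (3 * int k - 2)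
        (0 + (1/4 * ((3 * real k - 4) / 2 * f (k - 1)) + (\<Sum>i=1..n. f i * f (k - i))))"
      by (intro lead_add lead_R) auto
    \<comment> \<open>Since \<open>airy_gamma (k - 1) = (3k - 4) / 2\<close>, this is the recurrence
      of \<open>airy_phi\<close> divided by \<open>2 * 4^k\<close>.\<close>
    also have "0 + (1/4 * ((3 * real k - 4) / 2 * f (k - 1)) + (\<Sum>i=1..n. f i * f (k - i))) = f k"
    proof -
      have "f i * f (k - i) = airy_phi i * airy_phi (k - i) / (4 * 4 ^ k)" if "i \<in> {1..n}" for i
      proof -
        have "(4 :: real) ^ k = 4 ^ i * 4 ^ (k - i)"
          using that Suc by (simp flip: power_add)
        then show ?thesis by (simp add: f_def)
      qed
      then have "(\<Sum>i=1..n. f i * f (k - i)) =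
          (\<Sum>i=1..n. airy_phi i * airy_phi (k - i)) / (4 * 4 ^ k)"
        by (simp add: sum_divide_distrib)
      then show ?thesis
        by (simp add: Suc f_def airy_gamma_def field_simps)
    qed
    also have "R + (area_moment 0 * (dilated_moment k - area_moment k)
          + (\<Sum>i=1..n. area_moment i * dilated_moment (k - i))) = area_moment k * sqrt_pow (-1)"
    proof -
      have "{..k} = insert 0 (insert k {1..n})" "{..k} = insert 0 {1..k}"
        using Suc by auto
      then have eq: "area_moment k = R + 2 * fps_X * area_moment k + (area_moment 0 * dilated_moment k
          + area_moment k * area_moment 0 + (\<Sum>i=1..n. area_moment i * dilated_moment (k - i)))"
        using area_moment_eq[of k] Suc by (simp add: R_def dilated_moment_0 algebra_simps)
      have y: "sqrt_pow (-1) = 1 - 2 * fps_X - 2 * area_moment 0"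
        by (simp add: two_area_moment_0)
      have "R + (area_moment 0 * (dilated_moment k - area_moment k)
          + (\<Sum>i=1..n. area_moment i * dilated_moment (k - i)))
        = (R + 2 * fps_X * area_moment k + (area_moment 0 * dilated_moment k
            + area_moment k * area_moment 0 + (\<Sum>i=1..n. area_moment i * dilated_moment (k - i))))
          - 2 * fps_X * area_moment k - 2 * area_moment k * area_moment 0"
        by (simp add: algebra_simps)
      also have "\<dots> = area_moment k - 2 * fps_X * area_moment k - 2 * area_moment k * area_moment 0"
        by (simp only: flip: eq)
      also have "\<dots> = area_moment k * sqrt_pow (-1)"
        by (subst y) (simp add: algebra_simps)
      finally show ?thesis .
    qed
    finally have "lead (area_moment k * sqrt_pow (-1) * sqrt_pow 1) (3 * int k - 2 + 1) (f k * 1)"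
      by (intro lead_mult lead_sqrt_pow)
    then show ?thesis
      using Suc by (simp add: mult.assoc sqrt_pow_mult sqrt_pow_0 f_def flip: area_moment_pos)
  qed
qed

lemma area_moment_asymp:
  "(\<lambda>m. area_moment k $ m / (4 ^ m * real m powr (airy_gamma k - 1)))
    \<longlonglongrightarrow> airy_phi k / (2 * 4 ^ k) * rGamma (airy_gamma k)"
proof -
  have "of_int (3 * int k - 1) / 2 = airy_gamma k"
    by (simp add: airy_gamma_def diff_divide_distrib)
  with lead_asymp[OF lead_centred_moment[of k]]
  have "(\<lambda>m. centred_moment k $ m / (4 ^ m * real m powr (airy_gamma k - 1)))
    \<longlonglongrightarrow> airy_phi k / (2 * 4 ^ k) * rGamma (airy_gamma k)"
    by simp
  then show ?thesis
  proof (rule Lim_transform_eventually)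
    show "\<forall>\<^sub>F m in sequentially. centred_moment k $ m / (4 ^ m * real m powr (airy_gamma k - 1))
        = area_moment k $ m / (4 ^ m * real m powr (airy_gamma k - 1))"
      using eventually_gt_at_top[of 0] by eventually_elim (simp add: centred_moment_def)
  qed
qed

lemma rGamma_airy_gamma_0: "rGamma (airy_gamma 0) \<noteq> 0"
proof -
  have "(-1/2 :: real) \<notin> \<int>"
    by (auto elim!: Ints_cases simp: field_simps)
  then show ?thesis
    unfolding airy_gamma_def rGamma_eq_zero_iff using nonpos_Ints_subset_Ints by force
qed

lemma eventually_area_moment_0_nonzero: "eventually (\<lambda>m. area_moment 0 $ m \<noteq> 0) sequentially"
proof -
  have "airy_phi 0 / (2 * 4 ^ 0) * rGamma (airy_gamma 0) \<noteq> 0"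
    using rGamma_airy_gamma_0 by simp
  from tendsto_imp_eventually_ne[OF area_moment_asymp this] show ?thesis
    by eventually_elim auto
qed

text \<open>The growth \<open>4^m\<close> cancels, and
  \<open>airy_gamma k - airy_gamma 0 = 3k / 2\<close> yields the scale \<open>m^(3/2)\<close> per
  power of the area.\<close>

lemma area_moment_ratio:
  "(\<lambda>m. area_moment k $ m / area_moment 0 $ m / real m powr (3 * real k / 2))
    \<longlonglongrightarrow> Gamma (airy_gamma 0) / Gamma (airy_gamma k) * (airy_phi k / airy_phi 0) / 4 ^ k"
proof -
  have "(\<lambda>m. area_moment k $ m / (4 ^ m * real m powr (airy_gamma k - 1)) /
       (area_moment 0 $ m / (4 ^ m * real m powr (airy_gamma 0 - 1))))
    \<longlonglongrightarrow> airy_phi k / (2 * 4 ^ k) * rGamma (airy_gamma k) /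
       (airy_phi 0 / (2 * 4 ^ 0) * rGamma (airy_gamma 0))"
    using rGamma_airy_gamma_0 by (intro tendsto_divide area_moment_asymp) simp
  also have "airy_phi k / (2 * 4 ^ k) * rGamma (airy_gamma k) /
       (airy_phi 0 / (2 * 4 ^ 0) * rGamma (airy_gamma 0)) =
     Gamma (airy_gamma 0) / Gamma (airy_gamma k) * (airy_phi k / airy_phi 0) / 4 ^ k"
    by (simp add: rGamma_inverse_Gamma field_simps)
  finally show ?thesis
  proof (rule Lim_transform_eventually)
    have "airy_gamma k - 1 = (airy_gamma 0 - 1) + 3 * real k / 2"
      by (simp add: airy_gamma_def)
    then have *: "real m powr (airy_gamma k - 1)
        = real m powr (airy_gamma 0 - 1) * real m powr (3 * real k / 2)" for m
      by (simp only: powr_add)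
    show "\<forall>\<^sub>F m in sequentially. area_moment k $ m / (4 ^ m * real m powr (airy_gamma k - 1)) /
       (area_moment 0 $ m / (4 ^ m * real m powr (airy_gamma 0 - 1)))
       = area_moment k $ m / area_moment 0 $ m / real m powr (3 * real k / 2)"
      using eventually_gt_at_top[of 0] by eventually_elim (simp add: *)
  qed
qed

section \<open>Convergence of moments and in distribution\<close>

text \<open>By \<open>a! b! <= (a + b)!\<close> the \<open>n\<close> products sum to at most
  \<open>3^(n+1) n!\<close>. Their half and the linear term, at most \<open>3/2 n\<close> times the
  previous bound, contribute equal shares.\<close>

lemma abs_airy_phi_Suc_le: "\<bar>airy_phi (Suc n)\<bar> \<le> 3 ^ Suc n * fact n"
proof (induction n rule: less_induct)
  case (less n)
  show ?case
  proof (cases n)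
    case 0
    then show ?thesis by (simp add: airy_gamma_def)
  next
    case (Suc j)
    have "\<bar>airy_phi l * airy_phi (Suc n - l)\<bar> \<le> 3 ^ Suc n * fact j" if l: "l \<in> {1..n}" for l
    proof -
      obtain a b where ab: "l = Suc a" "Suc n - l = Suc b" "a + b = j"
        using l Suc by (intro that[of "l - 1" "n - l"]) auto
      have "fact a * fact b \<le> (fact (a + b) :: nat)"
        by (intro dvd_imp_le fact_fact_dvd_fact) simp
      then have fact_le: "fact a * fact b \<le> (fact j :: real)"
        using ab(3) by (metis of_nat_fact of_nat_le_iff of_nat_mult)
      have "\<bar>airy_phi l * airy_phi (Suc n - l)\<bar> = \<bar>airy_phi (Suc a)\<bar> * \<bar>airy_phi (Suc b)\<bar>"
        by (metis ab(1,2) abs_mult)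
      also have "\<dots> \<le> (3 ^ Suc a * fact a) * (3 ^ Suc b * fact b)"
        using ab(3) Suc by (intro mult_mono less.IH) auto
      also have "\<dots> = 3 ^ Suc n * (fact a * fact b)"
        by (simp add: Suc power_add flip: ab(3))
      also have "\<dots> \<le> 3 ^ Suc n * fact j"
        by (intro mult_left_mono fact_le) simp
      finally show ?thesis .
    qed
    then have "(\<Sum>l=1..n. \<bar>airy_phi l * airy_phi (Suc n - l)\<bar>) \<le> of_nat (card {1..n}) * (3 ^ Suc n * fact j)"
      by (rule sum_bounded_above)
    then have "\<bar>\<Sum>l=1..n. airy_phi l * airy_phi (Suc n - l)\<bar> \<le> real n * (3 ^ Suc n * fact j)"
      using order_trans[OF sum_abs] by simp
    also have "\<dots> = 3 ^ Suc n * fact n"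
      by (simp add: Suc)
    finally have 1: "\<bar>\<Sum>l=1..n. airy_phi l * airy_phi (Suc n - l)\<bar> \<le> 3 ^ Suc n * fact n" .
    have "\<bar>airy_gamma n * airy_phi n\<bar> \<le> 3 / 2 * real n * (3 ^ n * fact j)"
      unfolding abs_mult using less.IH[of j] Suc
      by (intro mult_mono) (auto simp: airy_gamma_def)
    also have "\<dots> = 3 ^ Suc n * fact n / 2"
      by (simp add: Suc)
    finally show ?thesis using 1 by simp
  qed
qed

lemma Gamma_plus3:
  fixes x :: real
  assumes "x > 0"
  shows "Gamma (x + 3) = x * (x + 1) * (x + 2) * Gamma x"
proof -
  have "Gamma (y + 1) = y * Gamma y" if "y > 0" for y :: real
    using that by (intro Gamma_plus1) (auto elim!: nonpos_Ints_cases)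
  from this[of x] this[of "x + 1"] this[of "x + 2"] show ?thesis
    using assms by (simp add: add.assoc)
qed

text \<open>In the ratio test the factorial gains two linear factors while \<open>Gamma\<close>,
  whose argument grows by 3, gains three.\<close>

lemma power_fact_div_Gamma_tendsto_0:
  fixes c :: real
  assumes "c \<ge> 0"
  shows "(\<lambda>k. c ^ k * fact (2 * k) / Gamma (airy_gamma (2 * k))) \<longlonglongrightarrow> 0"
proof -
  define a where "a k = c ^ k * fact (2 * k) / Gamma (airy_gamma (2 * k))" for k
  \<comment> \<open>The bounds \<open>2x\<close> and \<open>2 (x + 1)\<close> for the factorial's
    factors cost 4, and a ratio of \<open>1/2\<close> costs 2, hence \<open>8 c\<close>. The added 1
    gives \<open>k >= 1\<close> and so a positive argument of \<open>Gamma\<close>.\<close>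
  define N where "N = nat \<lceil>8 * c\<rceil> + 1"
  have "norm (a (Suc k)) \<le> 1 / 2 * norm (a k)" if k: "k \<ge> N" for k
  proof -
    define x where "x = airy_gamma (2 * k)"
    have "k \<ge> 1" "8 * c \<le> real k"
      using k unfolding N_def by linarith+
    then have x: "x = 3 * real k - 1 / 2" "x \<ge> 1" "8 * c \<le> x + 2"
      by (simp_all add: x_def airy_gamma_def)
    have Suc: "airy_gamma (2 * Suc k) = x + 3"
      by (simp add: x airy_gamma_def field_simps)
    have G: "Gamma x > 0"
      using x by (intro Gamma_real_pos) simp
    have "c * ((2 * real k + 1) * (2 * real k + 2)) \<le> c * ((2 * x) * (2 * (x + 1)))"
      using assms \<open>k \<ge> 1\<close> by (intro mult_left_mono mult_mono) (auto simp: x)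
    also have "\<dots> = 1 / 2 * (8 * c * (x * (x + 1)))"
      by simp
    also have "\<dots> \<le> 1 / 2 * ((x + 2) * (x * (x + 1)))"
      using x by (intro mult_left_mono mult_right_mono) auto
    finally have *: "c * ((2 * real k + 1) * (2 * real k + 2)) / (x * (x + 1) * (x + 2)) \<le> 1 / 2"
      using x(2) by (simp add: pos_divide_le_eq mult_ac)
    have a_nonneg: "a k \<ge> 0"
      using assms G by (simp add: a_def flip: x_def)
    have "fact (2 * Suc k) = (2 * real k + 1) * (2 * real k + 2) * fact (2 * k)"
      by (simp add: algebra_simps)
    moreover have "Gamma (x + 3) = x * (x + 1) * (x + 2) * Gamma x"
      using x(2) by (intro Gamma_plus3) simp
    ultimately have "a (Suc k) = c * ((2 * real k + 1) * (2 * real k + 2)) / (x * (x + 1) * (x + 2)) * a k"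
      unfolding a_def Suc x_def[symmetric] by (simp only: times_divide_times_eq power_Suc mult_ac)
    moreover have "0 \<le> c * ((2 * real k + 1) * (2 * real k + 2)) / (x * (x + 1) * (x + 2))"
      using assms x by simp
    ultimately have "0 \<le> a (Suc k)" "a (Suc k) \<le> 1 / 2 * a k"
      using mult_right_mono[OF * a_nonneg] a_nonneg by (simp_all only: mult_nonneg_nonneg)
    then show ?thesis
      using a_nonneg by simp
  qed
  then have "summable a"
    by (intro summable_ratio_test[of "1/2" N]) auto
  then show ?thesis
    unfolding a_def by (rule summable_LIMSEQ_zero)
qed

text \<open>The moment bound makes the Taylor expansion of the limiting characteristic function converge
  everywhere, and the remainder after an even number of terms is controlled by a moment, uniformly
  along the sequence.\<close>

lemma weak_conv_of_moments:
  fixes \<mu> :: "nat \<Rightarrow> real measure" and \<nu> :: "real measure"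
  assumes \<mu>: "\<And>n. real_distribution (\<mu> n)" "\<And>n k. integrable (\<mu> n) (\<lambda>x. x ^ k)"
    and \<nu>: "real_distribution \<nu>" "\<And>k. integrable \<nu> (\<lambda>x. x ^ k)"
    and conv: "\<And>k. (\<lambda>n. \<integral>x. x ^ k \<partial>\<mu> n) \<longlonglongrightarrow> (\<integral>x. x ^ k \<partial>\<nu>)"
    and growth: "\<And>t :: real. (\<lambda>k. t ^ (2 * k) / fact (2 * k) * (\<integral>x. x ^ (2 * k) \<partial>\<nu>)) \<longlonglongrightarrow> 0"
  shows "weak_conv_m \<mu> \<nu>"
proof (rule levy_continuity)
  fix t :: real
  show "(\<lambda>n. char (\<mu> n) t) \<longlonglongrightarrow> char \<nu> t"
  proof (rule tendstoI)
    fix e :: real assume "e > 0"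
    \<comment> \<open>The remainder bound \<open>B\<close> is twice this term, and in the limit it
      enters twice.\<close>
    with tendstoD[OF growth[of t], of "e / 4"] obtain k where
      k: "\<bar>t ^ (2 * k) / fact (2 * k) * (\<integral>x. x ^ (2 * k) \<partial>\<nu>)\<bar> < e / 4"
      by (force simp: eventually_sequentially)
    define B where "B \<rho> = 2 * \<bar>t\<bar> ^ (2 * k) / fact (2 * k) * (\<integral>x. \<bar>x\<bar> ^ (2 * k) \<partial>\<rho>)" for \<rho>
    define S where "S \<rho> = (\<Sum>j\<le>2 * k. ((\<i> * t) ^ j / fact j) * complex_of_real (\<integral>x. x ^ j \<partial>\<rho>))" for \<rho>
    have approx: "cmod (char \<rho> t - S \<rho>) \<le> B \<rho>"
      if "real_distribution \<rho>" "\<And>k. integrable \<rho> (\<lambda>x. x ^ k)" for \<rho>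
      unfolding S_def B_def using that by (intro real_distribution.char_approx1) auto
    have "(\<lambda>n. B (\<mu> n) + B \<nu> + cmod (S (\<mu> n) - S \<nu>)) \<longlonglongrightarrow> B \<nu> + B \<nu> + cmod (S \<nu> - S \<nu>)"
      unfolding B_def S_def power_even_abs[OF dvd_triv_left]
      by (intro tendsto_intros conv)
    moreover have "B \<nu> + B \<nu> + cmod (S \<nu> - S \<nu>) < e"
      using k by (simp add: B_def power_even_abs field_simps)
    ultimately have "\<forall>\<^sub>F n in sequentially. B (\<mu> n) + B \<nu> + cmod (S (\<mu> n) - S \<nu>) < e"
      by (rule order_tendstoD)
    then show "\<forall>\<^sub>F n in sequentially. dist (char (\<mu> n) t) (char \<nu> t) < e"
    proof eventually_elim
      case (elim n)
      have "dist (char (\<mu> n) t) (char \<nu> t)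
          = cmod ((char (\<mu> n) t - S (\<mu> n)) + (S (\<mu> n) - S \<nu>) - (char \<nu> t - S \<nu>))"
        by (simp add: dist_norm)
      also have "\<dots> \<le> cmod (char (\<mu> n) t - S (\<mu> n)) + cmod (S (\<mu> n) - S \<nu>) + cmod (char \<nu> t - S \<nu>)"
        by (rule order_trans[OF norm_triangle_ineq4 add_right_mono[OF norm_triangle_ineq]])
      also have "\<dots> \<le> B (\<mu> n) + B \<nu> + cmod (S (\<mu> n) - S \<nu>)"
        using approx[OF \<mu>, of n] approx[OF \<nu>] by simp
      finally show ?case using elim by simp
    qed
  qed
qed (use assms in auto)

text \<open>Point masses on \<open>A\<close> adding up to 1 force \<open>X\<close> into
  \<open>A\<close> almost surely, so \<open>f (X _)\<close> agrees almost everywhere with a finite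
  sum of indicators.\<close>

lemma (in prob_space) expectation_of_finite_distribution:
  fixes X :: "'a \<Rightarrow> real" and f :: "real \<Rightarrow> real"
  assumes [measurable]: "X \<in> borel_measurable M" "f \<in> borel_measurable borel"
    and "finite A" and p: "(\<Sum>n\<in>A. prob {\<omega> \<in> space M. X \<omega> = real n}) = 1"
  shows "integrable M (\<lambda>\<omega>. f (X \<omega>))"
    and "expectation (\<lambda>\<omega>. f (X \<omega>)) = (\<Sum>n\<in>A. f (real n) * prob {\<omega> \<in> space M. X \<omega> = real n})"
proof -
  define E where "E n = {\<omega> \<in> space M. X \<omega> = real n}" for n
  have [measurable]: "E n \<in> events" for n
    unfolding E_def by measurable
  have disj: "disjoint_family_on E A"
    by (auto simp: disjoint_family_on_def E_def)
  have "prob (\<Union>n\<in>A. E n) = 1"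
    using p \<open>finite A\<close> disj by (subst finite_measure_finite_Union) (auto simp: E_def)
  then have "AE \<omega> in M. \<omega> \<in> (\<Union>n\<in>A. E n)"
    using \<open>finite A\<close> by (intro AE_prob_1) auto
  then have AE: "AE \<omega> in M. f (X \<omega>) = (\<Sum>n\<in>A. f (real n) * indicator (E n) \<omega>)"
  proof eventually_elim
    case (elim \<omega>)
    then obtain n where n: "n \<in> A" "\<omega> \<in> E n" by blast
    have "(\<Sum>k\<in>A. f (real k) * indicator (E k) \<omega>) = (\<Sum>k\<in>A. if k = n then f (real k) else 0)"
      using n by (intro sum.cong) (auto simp: E_def)
    then show ?case using n \<open>finite A\<close> by (simp add: E_def)
  qed
  have int: "integrable M (\<lambda>\<omega>. \<Sum>n\<in>A. f (real n) * indicator (E n) \<omega>)"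
    by (intro Bochner_Integration.integrable_sum integrable_mult_right integrable_real_indicator)
      (auto simp: less_top[symmetric])
  show "integrable M (\<lambda>\<omega>. f (X \<omega>))"
    using int by (subst integrable_cong_AE[OF _ _ AE]) measurable
  have "expectation (\<lambda>\<omega>. f (X \<omega>)) = expectation (\<lambda>\<omega>. \<Sum>n\<in>A. f (real n) * indicator (E n) \<omega>)"
    by (intro integral_cong_AE AE) measurable
  also have "\<dots> = (\<Sum>n\<in>A. expectation (\<lambda>\<omega>. f (real n) * indicator (E n) \<omega>))"
    by (intro Bochner_Integration.integral_sum integrable_mult_right integrable_real_indicator)
      (auto simp: less_top[symmetric])
  finally show "expectation (\<lambda>\<omega>. f (X \<omega>)) = (\<Sum>n\<in>A. f (real n) * prob {\<omega> \<in> space M. X \<omega> = real n})"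
    by (simp add: E_def)
qed

section \<open>Probabilities as sums over polygons, and the limit law\<close>

lemma num_polygons_eq: "num_polygons m n = card {p \<in> polygons m. area p = n}"
  by (simp add: num_polygons_def polygons_def conj_assoc)

lemma sum_num_polygons:
  "(\<Sum>n\<in>area ` polygons m. f n * real (num_polygons m n)) = (\<Sum>p\<in>polygons m. f (area p))"
proof -
  have "(\<Sum>p\<in>polygons m. f (area p)) = (\<Sum>n\<in>area ` polygons m. \<Sum>p | p \<in> polygons m \<and> area p = n. f (area p))"
    by (rule sum.image_gen[OF finite_polygons])
  also have "\<dots> = (\<Sum>n\<in>area ` polygons m. f n * real (num_polygons m n))"
    by (rule sum.cong) (auto simp: num_polygons_eq)
  finally show ?thesis ..
qed

lemma suminf_num_polygons: "(\<Sum>n. real (num_polygons m n)) = area_moment 0 $ m"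
proof -
  have "(\<Sum>n. real (num_polygons m n)) = (\<Sum>n\<in>area ` polygons m. real (num_polygons m n))"
  proof (rule suminf_finite)
    fix n assume "n \<notin> area ` polygons m"
    then have "{p \<in> polygons m. area p = n} = {}" by auto
    then show "real (num_polygons m n) = 0"
      by (simp only: num_polygons_eq) simp
  qed (simp add: finite_polygons)
  then show ?thesis
    using sum_num_polygons[of "\<lambda>_. 1" m] by (simp add: area_moment_nth)
qed

text \<open>The even moments divided by \<open>(2k)!\<close> are at most a constant times
  \<open>9^k (2k)! / Gamma (airy_gamma (2k))\<close>, where \<open>9^k\<close> is
  \<open>3^(2k)\<close> from the bound on \<open>airy_phi\<close>.\<close>

lemma airy_moment_growth:
  assumes "airy_distributed N Y"
  shows "(\<lambda>k. t ^ (2 * k) / fact (2 * k) * (\<integral>\<omega>. (Y \<omega> / sqrt pi) ^ (2 * k) \<partial>N)) \<longlonglongrightarrow> 0"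
proof (rule Lim_null_comparison)
  define a where "a k = (9 * t\<^sup>2 / pi) ^ k * fact (2 * k) / Gamma (airy_gamma (2 * k))" for k
  have "(\<lambda>k. \<bar>Gamma (airy_gamma 0)\<bar> * a k) \<longlonglongrightarrow> \<bar>Gamma (airy_gamma 0)\<bar> * 0"
    unfolding a_def by (intro tendsto_intros power_fact_div_Gamma_tendsto_0) simp
  then show "(\<lambda>k. \<bar>Gamma (airy_gamma 0)\<bar> * a k) \<longlonglongrightarrow> 0"
    by simp
  show "\<forall>\<^sub>F k in sequentially. norm (t ^ (2 * k) / fact (2 * k) * (\<integral>\<omega>. (Y \<omega> / sqrt pi) ^ (2 * k) \<partial>N))
      \<le> \<bar>Gamma (airy_gamma 0)\<bar> * a k"
    using eventually_gt_at_top[of 0]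
  proof eventually_elim
    case (elim k)
    define I where "I = (\<integral>\<omega>. Y \<omega> ^ (2 * k) \<partial>N)"
    have G: "Gamma (airy_gamma (2 * k)) > 0"
      using elim by (intro Gamma_real_pos) (simp add: airy_gamma_def)
    have I: "I / fact (2 * k) = - (Gamma (airy_gamma 0) / Gamma (airy_gamma (2 * k)) * airy_phi (2 * k))"
      using assms by (simp add: airy_distributed_def I_def)
    obtain n where n: "2 * k = Suc n"
      using elim by (cases "2 * k") auto
    have "fact n \<le> (fact (2 * k) :: real)"
      using n by (intro fact_mono) simp
    then have fact_le: "3 ^ (2 * k) * fact n \<le> (9 ^ k * fact (2 * k) :: real)"
      by (simp add: power_mult)
    have "\<bar>airy_phi (2 * k)\<bar> \<le> 3 ^ (2 * k) * fact n"
      unfolding n by (rule abs_airy_phi_Suc_le)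
    also have "\<dots> \<le> 9 ^ k * fact (2 * k)"
      by (rule fact_le)
    finally have phi: "\<bar>airy_phi (2 * k)\<bar> \<le> 9 ^ k * fact (2 * k)" .
    have "(\<integral>\<omega>. (Y \<omega> / sqrt pi) ^ (2 * k) \<partial>N) = I / pi ^ k"
      by (simp add: I_def power_divide power_mult)
    then have "t ^ (2 * k) / fact (2 * k) * (\<integral>\<omega>. (Y \<omega> / sqrt pi) ^ (2 * k) \<partial>N)
        = (t\<^sup>2 / pi) ^ k * (I / fact (2 * k))"
      by (simp add: power_divide power_mult)
    then have "\<bar>t ^ (2 * k) / fact (2 * k) * (\<integral>\<omega>. (Y \<omega> / sqrt pi) ^ (2 * k) \<partial>N)\<bar>
        = (t\<^sup>2 / pi) ^ k * (\<bar>Gamma (airy_gamma 0)\<bar> / Gamma (airy_gamma (2 * k))) * \<bar>airy_phi (2 * k)\<bar>"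
      unfolding I using G by (simp add: abs_mult)
    also have "\<dots> \<le> (t\<^sup>2 / pi) ^ k * (\<bar>Gamma (airy_gamma 0)\<bar> / Gamma (airy_gamma (2 * k)))
        * (9 ^ k * fact (2 * k))"
      using G phi by (intro mult_left_mono) auto
    also have "\<dots> = \<bar>Gamma (airy_gamma 0)\<bar> * a k"
      by (simp add: a_def power_mult_distrib power_divide)
    finally show ?case by simp
  qed
qed

theorem theorem3:
  fixes M :: "nat \<Rightarrow> 'a measure" and Xt X :: "nat \<Rightarrow> 'a \<Rightarrow> real"
    and N :: "'b measure" and Y :: "'b \<Rightarrow> real"
  assumes "\<And>m. m \<ge> 2 \<Longrightarrow> prob_space (M m)"
    and "\<And>m. m \<ge> 2 \<Longrightarrow> Xt m \<in> borel_measurable (M m)"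
    and "\<And>m n. m \<ge> 2 \<Longrightarrow>
      measure (M m) {\<omega> \<in> space (M m). Xt m \<omega> = real n}
        = real (num_polygons m n) / (\<Sum>n. real (num_polygons m n))"
    and "\<And>m \<omega>. m \<ge> 2 \<Longrightarrow> X m \<omega> = Xt m \<omega> / real m powr (3 / 2)"
    and "airy_distributed N Y"
  shows "weak_conv_m (\<lambda>m. distr (M m) borel (\<lambda>\<omega>. X m \<omega> / (sqrt pi / 4)))
           (distr N borel (\<lambda>\<omega>. Y \<omega> / sqrt pi))
    \<and> (\<forall>k::nat. (\<lambda>m. \<integral>\<omega>. (X m \<omega> / (sqrt pi / 4)) ^ k \<partial>M m)
           \<longlonglongrightarrow> (\<integral>\<omega>. (Y \<omega> / sqrt pi) ^ k \<partial>N))"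
proof -
  \<comment> \<open>From \<open>m0\<close> on, the normalising total is nonzero and the point masses
    do add up to 1.\<close>
  obtain m0 where m0: "m0 \<ge> 2" "\<And>m. m \<ge> m0 \<Longrightarrow> area_moment 0 $ m \<noteq> 0"
    using eventually_conj[OF eventually_area_moment_0_nonzero eventually_ge_at_top[of 2]]
    by (auto simp: eventually_sequentially dest: spec[of _ "max _ 2"])
  define Z where "Z m \<omega> = X m \<omega> / (sqrt pi / 4)" for m \<omega>
  define c where "c m = real m powr (3 / 2) * (sqrt pi / 4)" for m
  have Z: "Z m = (\<lambda>\<omega>. Xt m \<omega> / c m)" if "m \<ge> 2" for m
    by (rule ext) (simp add: Z_def c_def assms(4)[OF that])
  have Z_meas: "Z m \<in> borel_measurable (M m)" if "m \<ge> 2" for m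
    using assms(2)[OF that] by (simp add: Z[OF that])
  have "integrable (M m) (\<lambda>\<omega>. Z m \<omega> ^ k) \<and>
      (\<integral>\<omega>. Z m \<omega> ^ k \<partial>M m) = fact k * (area_moment k $ m / area_moment 0 $ m) / c m ^ k"
    if m: "m \<ge> m0" for m k
  proof -
    have "m \<ge> 2" using m m0 by simp
    interpret prob_space "M m" using assms(1)[OF \<open>m \<ge> 2\<close>] .
    have p: "prob {\<omega> \<in> space (M m). Xt m \<omega> = real n} = real (num_polygons m n) / area_moment 0 $ m" for n
      using assms(3)[OF \<open>m \<ge> 2\<close>] by (simp add: suminf_num_polygons)
    have sum_p: "(\<Sum>n\<in>area ` polygons m. f n * prob {\<omega> \<in> space (M m). Xt m \<omega> = real n})
        = (\<Sum>p\<in>polygons m. f (area p)) / area_moment 0 $ m" for f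
      unfolding p by (simp add: sum_num_polygons flip: sum_divide_distrib)
    have "(\<Sum>n\<in>area ` polygons m. prob {\<omega> \<in> space (M m). Xt m \<omega> = real n}) = 1"
      using sum_p[of "\<lambda>_. 1"] m0(2)[OF m] by (simp add: area_moment_nth)
    note * = expectation_of_finite_distribution[OF assms(2)[OF \<open>m \<ge> 2\<close>] _ _ this,
        of "\<lambda>x. (x / c m) ^ k"]
    have "expectation (\<lambda>\<omega>. (Xt m \<omega> / c m) ^ k) =
        (\<Sum>p\<in>polygons m. (real (area p) / c m) ^ k) / area_moment 0 $ m"
      using *(2) finite_polygons sum_p[of "\<lambda>n. (real n / c m) ^ k"] by simp
    also have "(\<Sum>p\<in>polygons m. (real (area p) / c m) ^ k) = fact k * area_moment k $ m / c m ^ k"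
      by (simp add: area_moment_nth power_divide flip: sum_divide_distrib)
    finally show ?thesis
      using *(1) finite_polygons by (simp add: Z[OF \<open>m \<ge> 2\<close>])
  qed
  then have Z_int: "integrable (M m) (\<lambda>\<omega>. Z m \<omega> ^ k)"
    and Z_moment: "(\<integral>\<omega>. Z m \<omega> ^ k \<partial>M m) = fact k * (area_moment k $ m / area_moment 0 $ m) / c m ^ k"
    if "m \<ge> m0" for m k
    using that by blast+
  have Y: "prob_space N" "Y \<in> borel_measurable N" "integrable N (\<lambda>\<omega>. Y \<omega> ^ k)"
    "(\<integral>\<omega>. Y \<omega> ^ k \<partial>N) / fact k = Gamma (airy_gamma 0) / Gamma (airy_gamma k) * (airy_phi k / airy_phi 0)"
    for k using assms(5) by (auto simp only: airy_distributed_def)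
  have moments: "(\<lambda>m. \<integral>\<omega>. Z m \<omega> ^ k \<partial>M m) \<longlonglongrightarrow> (\<integral>\<omega>. (Y \<omega> / sqrt pi) ^ k \<partial>N)" for k
  proof -
    \<comment> \<open>The factorial undoes the division by \<open>k!\<close> in
      \<open>area_moment\<close>, and \<open>4^k\<close> cancels against the limit in
      \<open>area_moment_ratio\<close>.\<close>
    define d where "d = fact k / (sqrt pi / 4) ^ k"
    have "(\<lambda>m. d * (area_moment k $ m / area_moment 0 $ m / real m powr (3 * real k / 2)))
        \<longlonglongrightarrow> d * ((\<integral>\<omega>. Y \<omega> ^ k \<partial>N) / fact k / 4 ^ k)"
      unfolding Y(4) by (intro tendsto_intros area_moment_ratio)
    also have "d * ((\<integral>\<omega>. Y \<omega> ^ k \<partial>N) / fact k / 4 ^ k) = (\<integral>\<omega>. (Y \<omega> / sqrt pi) ^ k \<partial>N)"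
      by (simp add: d_def power_divide)
    finally show ?thesis
    proof (rule Lim_transform_eventually)
      show "\<forall>\<^sub>F m in sequentially. d * (area_moment k $ m / area_moment 0 $ m / real m powr (3 * real k / 2))
          = (\<integral>\<omega>. Z m \<omega> ^ k \<partial>M m)"
        using eventually_ge_at_top[of m0]
      proof eventually_elim
        case (elim m)
        have "c m ^ k = real m powr (3 * real k / 2) * (sqrt pi / 4) ^ k"
          unfolding c_def power_mult_distrib using elim m0 by (simp add: powr_power mult_ac)
        then show ?case
          by (simp add: Z_moment[OF elim] d_def)
      qed
    qed
  qed
  \<comment> \<open>The criterion needs distributions with all moments at every index, so the
    sequence is shifted by \<open>m0\<close>; limits do not see the shift.\<close>
  have "weak_conv_m (\<lambda>n. distr (M (n + m0)) borel (Z (n + m0))) (distr N borel (\<lambda>\<omega>. Y \<omega> / sqrt pi))"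
  proof (rule weak_conv_of_moments)
    note [measurable] = Y(2) Z_meas
    have m0': "n + m0 \<ge> 2" for n
      using m0 by simp
    have [measurable]: "Z (n + m0) \<in> borel_measurable (M (n + m0))" for n
      by (rule Z_meas[OF m0'])
    show "real_distribution (distr (M (n + m0)) borel (Z (n + m0)))" for n
      by (intro prob_space.real_distribution_distr assms(1) m0') measurable
    show "real_distribution (distr N borel (\<lambda>\<omega>. Y \<omega> / sqrt pi))"
      by (intro prob_space.real_distribution_distr Y(1)) measurable
    show "integrable (distr (M (n + m0)) borel (Z (n + m0))) (\<lambda>x. x ^ k)" for n k
      by (subst integrable_distr_eq) (auto intro: Z_int)
    show "integrable (distr N borel (\<lambda>\<omega>. Y \<omega> / sqrt pi)) (\<lambda>x. x ^ k)" for k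
      by (subst integrable_distr_eq) (auto simp: power_divide intro: Y(3))
    show "(\<lambda>n. \<integral>x. x ^ k \<partial>distr (M (n + m0)) borel (Z (n + m0)))
        \<longlonglongrightarrow> (\<integral>x. x ^ k \<partial>distr N borel (\<lambda>\<omega>. Y \<omega> / sqrt pi))" for k
      using LIMSEQ_ignore_initial_segment[OF moments, of m0 k] by (simp add: integral_distr)
    show "(\<lambda>k. t ^ (2 * k) / fact (2 * k) * (\<integral>x. x ^ (2 * k) \<partial>distr N borel (\<lambda>\<omega>. Y \<omega> / sqrt pi)))
        \<longlonglongrightarrow> 0" for t
      using airy_moment_growth[OF assms(5), of t] by (simp add: integral_distr)
  qed
  then have "weak_conv_m (\<lambda>m. distr (M m) borel (Z m)) (distr N borel (\<lambda>\<omega>. Y \<omega> / sqrt pi))"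
    unfolding weak_conv_m_def weak_conv_def by (blast intro: LIMSEQ_offset)
  with moments show ?thesis
    unfolding Z_def by blast
qed

end
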